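(* Let $K$ be a p.c.f. self-similar set generated by an IFS $F_i(x)=\rho(x-b_i)+b_i$, $1\le i\le N$, on $\mathbb R^d$ with $0<\rho<1$. Assume that the asymptotic geometric growth rates $R(p,q)$ $(>1)$ of the traces $R_n(p,q)$ exist for all $p\neq q$ in $V_0$, and let $$R^*=\min\{R(p,q):\ p\ne q,\ p,q\in V_0\}.$$ Then for the Besov spaces $B^\sigma_{2,\infty}$ defined on $K$, the critical exponent is $\sigma^*=\frac12\Big(\frac{\log R^*}{-\log\rho}+\alpha\Big)$. Furthermore, at $\sigma^*$: (i) if $(R^* )^n\le R_n(p,q)$ for all $n\ge0$ and all $p\neq q$ in $V_0$, then $B^{\sigma^*}_{2,\infty}$ is dense in $C(K)$; (ii) if $\lim_{n\to\infty}\frac{(R^* )^n}{R_n(p,q)}=\infty$ for some $p\neq q$ in $V_0$, then $B^{\sigma^*}_{2,\infty}$ is not dense in $C(K)$.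
   Context: **P.c.f. setting.** $K=\bigcup_{i=1}^NF_i(K)$ is the nonempty compact self-similar set, assumed connected. For a word $\omega=\omega_1\cdots\omega_n\in\{1,\dots,N\}^n$, $|\omega|=n$, put $F_\omega=F_{\omega_1}\circ\cdots\circ F_{\omega_n}$, $K_\omega=F_\omega(K)$. Let $\pi:\{1,\dots,N\}^{\infty}\to K$ be $\{\pi(\omega)\}=\bigcap_nK_{\omega_1\cdots\omega_n}$, $\tau$ the left shift, $\mathcal C=\pi^{-1}(\bigcup_{i<j}(K_i\cap K_j))$ and $\mathcal P=\bigcup_{m\ge1}\tau^m(\mathcal C)$. The IFS (and $K$) is p.c.f. (post-critically finite) if $\mathcal P$ is finite. The boundary is $V_0=\pi(\mathcal P)$, assumed to have at least two points; $V_n=\bigcup_iF_i(V_{n-1})$, $V_*=\bigcup_nV_n$, and $V_\omega=F_\omega(V_0)$, $|\omega|=n$, is an $n$-cell. Let $\alpha=\log N/|\log\rho|=\dim_HK$ and let $\mu$ be the self-similar measure $\mu=\frac1N\sum_i\mu\circ F_i^{-1}$ (the normalized $\alpha$-Hausdorff measure, which is $\alpha$-regular). **Besov spaces.** For $\sigma>0$, $[u]^2_{B^\sigma_{2,\infty}}=\sup_{0<r<1}r^{-\alpha-2\sigma}\int_K\int_{B(x,r)}|u(x)-u(y)|^2d\mu(y)d\mu(x)$ and $B^\sigma_{2,\infty}=\{u\in L^2(K,\mu):\|u\|_2+[u]_{B^\sigma_{2,\infty}}<\infty\}$. When $2\sigma>\alpha$, elements of $B^\sigma_{2,\infty}$ have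 continuous representatives and $B^\sigma_{2,\infty}$ is regarded as a subset of $C(K)$. $\sigma^*=\sup\{\sigma: B^\sigma_{2,\infty}\cap C(K)\text{ is dense in }C(K)\}$ (sup norm). **Primal energy and traces.** For $u:V_n\to\mathbb R$ the primal energy is $E_n[u]=\sum_{|\omega|=n}\sum_{\{x,y\}\subset V_\omega}|u(x)-u(y)|^2$ (unordered pairs). The trace (induced resistance) $R_n(p,q)$, $p\neq q\in V_0$, is defined by: for all $u:V_0\to\mathbb R$, $\min\{E_n[v]: v:V_n\to\mathbb R,\ v|_{V_0}=u\}=\sum_{\{p,q\}\subset V_0}\frac1{R_n(p,q)}|u(p)-u(q)|^2$. An increasing sequence $(R_n)$ of positive reals has asymptotic geometric growth rate $R>1$ if for every $\varepsilon>0$ there is $N(\varepsilon)$ with $R^{(1-\varepsilon)n}\le R_n\le R^{(1+\varepsilon)n}$ for all $n\ge N(\varepsilon)$; $R(p,q)$ denotes the rate of $(R_n(p,q))_n$. *)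

theory Defs
  imports "HOL-Analysis.Analysis"
begin

section \<open>Iterated function systems and p.c.f. sets\<close>

text \<open>
  The alphabet is \<open>{1..N}\<close>; finite words are lists over it and infinite words are functions
  \<open>nat \<Rightarrow> nat\<close> into it, with the first letter at position \<open>0\<close>.
\<close>

definition homothety :: "real \<Rightarrow> 'a::real_vector \<Rightarrow> 'a \<Rightarrow> 'a" where
  "homothety \<rho> c x = \<rho> *\<^sub>R (x - c) + c"

definition self_similar_set :: "(nat \<Rightarrow> 'a::topological_space \<Rightarrow> 'a) \<Rightarrow> nat \<Rightarrow> 'a set \<Rightarrow> bool" where
  "self_similar_set F N K \<longleftrightarrow> compact K \<and> K \<noteq> {} \<and> K = (\<Union>i\<in>{1..N}. F i ` K)"

definition words :: "nat \<Rightarrow> nat \<Rightarrow> nat list set" where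
  "words N n = {w. length w = n \<and> set w \<subseteq> {1..N}}"

definition infinite_words :: "nat \<Rightarrow> (nat \<Rightarrow> nat) set" where
  "infinite_words N = {\<omega>. range \<omega> \<subseteq> {1..N}}"

primrec word_map :: "(nat \<Rightarrow> 'a \<Rightarrow> 'a) \<Rightarrow> nat list \<Rightarrow> 'a \<Rightarrow> 'a" where
  "word_map F [] = id"
| "word_map F (i # w) = F i \<circ> word_map F w"

text \<open>
  The coding map \<open>\<pi>\<close>. For contractions of a self-similar set the intersection is a singleton.
\<close>

definition coding :: "(nat \<Rightarrow> 'a \<Rightarrow> 'a) \<Rightarrow> 'a set \<Rightarrow> (nat \<Rightarrow> nat) \<Rightarrow> 'a" where
  "coding F K \<omega> = the_elem (\<Inter>n. word_map F (map \<omega> [0..<n]) ` K)"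

definition shift :: "(nat \<Rightarrow> nat) \<Rightarrow> nat \<Rightarrow> nat" where
  "shift \<omega> = (\<lambda>n. \<omega> (Suc n))"

definition critical_set :: "(nat \<Rightarrow> 'a \<Rightarrow> 'a) \<Rightarrow> nat \<Rightarrow> 'a set \<Rightarrow> (nat \<Rightarrow> nat) set" where
  "critical_set F N K =
     {\<omega> \<in> infinite_words N. coding F K \<omega> \<in> (\<Union>j\<in>{1..N}. \<Union>i\<in>{1..<j}. F i ` K \<inter> F j ` K)}"

definition post_critical_set :: "(nat \<Rightarrow> 'a \<Rightarrow> 'a) \<Rightarrow> nat \<Rightarrow> 'a set \<Rightarrow> (nat \<Rightarrow> nat) set" where
  "post_critical_set F N K = (\<Union>m\<in>{1..}. (shift ^^ m) ` critical_set F N K)"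

definition pcf :: "(nat \<Rightarrow> 'a \<Rightarrow> 'a) \<Rightarrow> nat \<Rightarrow> 'a set \<Rightarrow> bool" where
  "pcf F N K \<longleftrightarrow> finite (post_critical_set F N K)"

definition boundary :: "(nat \<Rightarrow> 'a \<Rightarrow> 'a) \<Rightarrow> nat \<Rightarrow> 'a set \<Rightarrow> 'a set" where
  "boundary F N K = coding F K ` post_critical_set F N K"


section \<open>Primal energy, traces and growth rates\<close>

text \<open>
  Sums over unordered pairs of distinct points are written as one half of the sum over ordered
  pairs. Functions on the vertex set \<open>V\<^sub>n\<close> are represented by total functions: since \<open>V\<^sub>n\<close> is
  the union of the \<open>n\<close>-cells \<open>F\<^sub>\<omega> V\<^sub>0\<close>, the energy depends only on the values on \<open>V\<^sub>n\<close>.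
\<close>

definition primal_energy ::
  "(nat \<Rightarrow> 'a \<Rightarrow> 'a) \<Rightarrow> nat \<Rightarrow> 'a set \<Rightarrow> nat \<Rightarrow> ('a \<Rightarrow> real) \<Rightarrow> real" where
  "primal_energy F N K n u =
     (\<Sum>w\<in>words N n. (1/2) *
        (\<Sum>x\<in>word_map F w ` boundary F N K. \<Sum>y\<in>word_map F w ` boundary F N K - {x}.
           \<bar>u x - u y\<bar>\<^sup>2))"

definition pair_form :: "'a set \<Rightarrow> ('a \<Rightarrow> 'a \<Rightarrow> real) \<Rightarrow> ('a \<Rightarrow> real) \<Rightarrow> real" where
  "pair_form V r u = (1/2) * (\<Sum>p\<in>V. \<Sum>q\<in>V - {p}. (1 / r p q) * \<bar>u p - u q\<bar>\<^sup>2)"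

text \<open>
  \<open>r\<close> is the trace of the \<open>n\<close>-th primal energy: its quadratic form is the minimum (attained) of the
  energy over all extensions of the boundary data. Symmetry makes \<open>r\<close> a function of unordered
  pairs, and positivity excludes the convention \<open>1 / 0 = 0\<close>.
\<close>

definition is_trace ::
  "(nat \<Rightarrow> 'a \<Rightarrow> 'a) \<Rightarrow> nat \<Rightarrow> 'a set \<Rightarrow> nat \<Rightarrow> ('a \<Rightarrow> 'a \<Rightarrow> real) \<Rightarrow> bool" where
  "is_trace F N K n r \<longleftrightarrow>
     (\<forall>p\<in>boundary F N K. \<forall>q\<in>boundary F N K. p \<noteq> q \<longrightarrow> r p q = r q p \<and> 0 < r p q) \<and>
     (\<forall>u. (\<exists>v. (\<forall>x\<in>boundary F N K. v x = u x) \<and>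
               primal_energy F N K n v = pair_form (boundary F N K) r u) \<and>
          (\<forall>v. (\<forall>x\<in>boundary F N K. v x = u x) \<longrightarrow>
               pair_form (boundary F N K) r u \<le> primal_energy F N K n v))"

definition has_growth_rate :: "(nat \<Rightarrow> real) \<Rightarrow> real \<Rightarrow> bool" where
  "has_growth_rate a R \<longleftrightarrow>
     incseq a \<and> (\<forall>n. 0 < a n) \<and> 1 < R \<and>
     (\<forall>\<epsilon>>0. \<exists>M. \<forall>n\<ge>M. R powr ((1 - \<epsilon>) * real n) \<le> a n \<and> a n \<le> R powr ((1 + \<epsilon>) * real n))"


section \<open>Self-similar measure and Besov spaces\<close>

definition self_similar_measure ::
  "(nat \<Rightarrow> 'a::topological_space \<Rightarrow> 'a) \<Rightarrow> nat \<Rightarrow> 'a set \<Rightarrow> 'a measure \<Rightarrow> bool" where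
  "self_similar_measure F N K \<mu> \<longleftrightarrow>
     sets \<mu> = sets (restrict_space borel K) \<and> emeasure \<mu> K = 1 \<and>
     (\<forall>A\<in>sets \<mu>. measure \<mu> A = (1 / real N) * (\<Sum>i=1..N. measure \<mu> (F i -` A \<inter> K)))"

text \<open>
  The square of the Besov seminorm, with values in \<open>[0, \<infinity>]\<close>; the underlying space of \<open>\<mu>\<close> is \<open>K\<close>.
\<close>

definition besov_seminorm_sq ::
  "'a::metric_space measure \<Rightarrow> real \<Rightarrow> real \<Rightarrow> ('a \<Rightarrow> real) \<Rightarrow> ennreal" where
  "besov_seminorm_sq \<mu> \<alpha> \<sigma> u =
     (SUP r\<in>{0<..<1}. ennreal (r powr (- \<alpha> - 2 * \<sigma>)) *
        (\<integral>\<^sup>+x. (\<integral>\<^sup>+y\<in>ball x r. ennreal (\<bar>u x - u y\<bar>\<^sup>2) \<partial>\<mu>) \<partial>\<mu>))"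

text \<open>Elements are functions, not classes modulo equality almost everywhere.\<close>

definition besov :: "'a::metric_space measure \<Rightarrow> real \<Rightarrow> real \<Rightarrow> ('a \<Rightarrow> real) set" where
  "besov \<mu> \<alpha> \<sigma> =
     {u \<in> borel_measurable \<mu>.
        (\<integral>\<^sup>+x. ennreal (\<bar>u x\<bar>\<^sup>2) \<partial>\<mu>) < \<infinity> \<and> besov_seminorm_sq \<mu> \<alpha> \<sigma> u < \<infinity>}"

text \<open>
  Density in \<open>C(K)\<close>, for the sup norm, of the continuous functions belonging to \<open>S\<close>. For a Besov
  space with \<open>2 * \<sigma> > \<alpha>\<close>, the continuous functions in it are exactly the continuous
  representatives of its elements.
\<close>

definition dense_in_C :: "'a::topological_space set \<Rightarrow> ('a \<Rightarrow> real) set \<Rightarrow> bool" where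
  "dense_in_C K S \<longleftrightarrow>
     (\<forall>f. continuous_on K f \<longrightarrow>
        (\<forall>\<epsilon>>0. \<exists>u\<in>S. continuous_on K u \<and> (\<forall>x\<in>K. \<bar>f x - u x\<bar> < \<epsilon>)))"

text \<open>The supremum is taken in the extended reals, where it always exists.\<close>

definition critical_exponent :: "'a::metric_space set \<Rightarrow> 'a measure \<Rightarrow> real \<Rightarrow> ereal" where
  "critical_exponent K \<mu> \<alpha> = (SUP \<sigma>\<in>{\<sigma>. 0 < \<sigma> \<and> dense_in_C K (besov \<mu> \<alpha> \<sigma>)}. ereal \<sigma>)"

end

theory Submission
  imports Defs
begin

text \<open>
  Everything is read off on the cells \<open>F\<^sub>w(K)\<close>, \<open>|w| = n\<close>, which are translates of \<open>\<rho>\<^sup>n K\<close>. Two facts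
  tie the Besov scale \<open>r\<close> to the cells of level \<open>n\<close> with \<open>\<rho>\<^sup>n\<close> comparable to \<open>r\<close>. Distinct cells of equal
  level meet only in vertices \<open>F\<^sub>w(V\<^sub>0)\<close> (\<open>cell_meets_in_boundary\<close>), because an address of a common point
  is critical and its tail is post-critical. Hence two meeting cells differ, after rescaling, by one of
  the finitely many vectors \<open>p - q\<close> with \<open>p, q \<in> V\<^sub>0\<close>. This finiteness bounds the number of neighbours of
  a cell and keeps disjoint cells at distance at least \<open>c \<rho>\<^sup>n\<close> (\<open>disjoint_cells_separated\<close>).

  Upper bound for the exponent. If \<open>2 \<sigma> > \<alpha>\<close> and \<open>u\<close> is continuous with finite Besov seminorm, then
  \<open>E\<^sub>n[u] \<le> C \<rho>\<^bsup>(2\<sigma> - \<alpha>)n\<^esup>\<close> for large \<open>n\<close> (\<open>primal_energy_le_besov\<close>): the value at a vertex is the limit of the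
  means over the cells shrinking to it, and the successive differences of these means are controlled by
  the double integral near the diagonal and form a geometric series. As the trace is the least energy
  of an extension, \<open>|u(p) - u(q)|\<^sup>2 / R\<^sub>n(p,q) \<le> E\<^sub>n[u]\<close>. A dense space contains some \<open>u\<close> that separates \<open>p\<close>
  from \<open>q\<close>, so \<open>\<rho>\<^bsup>-(2\<sigma> - \<alpha>)n\<^esup> / R\<^sub>n(p,q)\<close> stays bounded (\<open>trace_lower_bound_if_dense\<close>). For a pair with
  \<open>R(p,q) = R\<^sup>*\<close> this fails if \<open>\<sigma> > \<sigma>\<^sup>*\<close>, and at \<open>\<sigma>\<^sup>*\<close>, where \<open>\<rho>\<^bsup>-(2\<sigma> - \<alpha>)\<^esup> = R\<^sup>*\<close>, it contradicts the
  hypothesis of part (ii).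

  Lower bound. If \<open>R\<^sub>m(p,q) \<ge> \<Lambda> > 1\<close> for one level \<open>m\<close> and all pairs, then boundary data \<open>g\<close> extend from \<open>V\<^sub>0\<close>
  to a continuous function on \<open>K\<close> with \<open>E\<^sub>m \<le> E\<^sub>0[g] / \<Lambda>\<close> and values in \<open>[min g, max g]\<close>. The constant here
  is exactly \<open>1\<close>, so the construction can be repeated inside every cell: \<open>k\<close> repetitions divide the energy
  by \<open>\<Lambda>\<^sup>k\<close>. The bound on the range makes the iterates converge uniformly, and in the limit bounds the
  oscillation on a cell by the differences at its vertices (\<open>approximation_of_small_energy\<close>). Summing over
  pairs of meeting cells, the limit lies in the Besov space as soon as \<open>\<Lambda> \<ge> \<rho>\<^bsup>-(2\<sigma> - \<alpha>)m\<^esup>\<close>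
  (\<open>besov_of_decaying_oscillation\<close>), and starting the iteration at a fine level approximates any
  continuous function. For \<open>\<sigma> < \<sigma>\<^sup>*\<close> the growth rates provide such an \<open>m\<close>; under the hypothesis of part (i)
  one takes \<open>\<sigma> = \<sigma>\<^sup>*\<close>, \<open>m = 1\<close> and \<open>\<Lambda> = R\<^sup>*\<close>.
\<close>

section \<open>Words and iterated homotheties\<close>

lemma word_map_append: "word_map F (v @ w) x = word_map F v (word_map F w x)"
  by (induction v) auto

lemma word_map_homothety:
  "word_map (\<lambda>i. homothety \<rho> (b i)) w x
     = \<rho> ^ length w *\<^sub>R x + word_map (\<lambda>i. homothety \<rho> (b i)) w 0"
proof (induction w arbitrary: x)
  case (Cons i w)
  show ?case
    by (subst (1) word_map.simps, simp only: comp_apply, subst Cons.IH)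
      (simp add: homothety_def algebra_simps)
qed simp

lemma finite_words [simp]: "finite (words N n)"
  unfolding words_def by (rule finite_subset[OF _ finite_lists_length_eq[of "{1..N}" n]]) auto

lemma words_0 [simp]: "words N 0 = {[]}"
  by (auto simp: words_def)

lemma length_words: "w \<in> words N n \<Longrightarrow> length w = n"
  by (simp add: words_def)

lemma words_append: "v \<in> words N m \<Longrightarrow> w \<in> words N n \<Longrightarrow> v @ w \<in> words N (m + n)"
  by (auto simp: words_def)

lemma words_add: "words N (m + n) = (\<lambda>(v, w). v @ w) ` (words N m \<times> words N n)"
proof -
  have "w \<in> (\<lambda>(v, w). v @ w) ` (words N m \<times> words N n)" if "w \<in> words N (m + n)" for w
  proof (rule image_eqI[of _ _ "(take m w, drop m w)"])
    show "(take m w, drop m w) \<in> words N m \<times> words N n"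
      using that set_take_subset[of m w] set_drop_subset[of m w] by (auto simp: words_def)
  qed simp
  then show ?thesis by (auto intro: words_append)
qed

lemma sum_words_add:
  "(\<Sum>w\<in>words N (m + n). f w) = (\<Sum>v\<in>words N m. \<Sum>w\<in>words N n. f (v @ w))"
proof -
  have "inj_on (\<lambda>(v, w). v @ w) (words N m \<times> words N n)"
    by (auto simp: inj_on_def words_def)
  then have "(\<Sum>w\<in>words N (m + n). f w) = (\<Sum>x\<in>words N m \<times> words N n. f (case x of (v, w) \<Rightarrow> v @ w))"
    unfolding words_add by (simp only: sum.reindex o_def)
  then show ?thesis
    by (simp add: sum.cartesian_product case_prod_beta)
qed

lemma words_1: "words N (Suc 0) = (\<lambda>i. [i]) ` {1..N}"
  by (auto simp: words_def length_Suc_conv)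

lemma sum_words_1: "(\<Sum>w\<in>words N (Suc 0). f w) = (\<Sum>i\<in>{1..N}. f [i])"
  unfolding words_1 by (subst sum.reindex) (auto simp: inj_on_def)

lemma sum_words_Suc:
  "(\<Sum>w\<in>words N (Suc n). f w) = (\<Sum>v\<in>words N n. \<Sum>i\<in>{1..N}. f (v @ [i]))"
  using sum_words_add[of f N n "Suc 0"] by (simp add: sum_words_1)

lemma words_SucE:
  assumes "w \<in> words N (Suc n)"
  obtains v i where "w = v @ [i]" "v \<in> words N n" "i \<in> {1..N}"
  using assms words_add[of N n "Suc 0"] by (auto simp: words_1)

lemma words_Suc_ConsE:
  assumes "w \<in> words N (Suc n)"
  obtains v i where "w = i # v" "v \<in> words N n" "i \<in> {1..N}"
  using assms by (cases w) (auto simp: words_def)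

lemma prefix_in_words: "\<omega> \<in> infinite_words N \<Longrightarrow> map \<omega> [0..<n] \<in> words N n"
  by (auto simp: words_def infinite_words_def)

lemma funpow_shift: "(shift ^^ n) \<omega> = (\<lambda>k. \<omega> (n + k))"
  by (induction n arbitrary: \<omega>) (auto simp: shift_def funpow_Suc_right simp del: funpow.simps)

lemma shift_infinite_words: "\<omega> \<in> infinite_words N \<Longrightarrow> (shift ^^ n) \<omega> \<in> infinite_words N"
  by (auto simp: funpow_shift infinite_words_def)

lemma prefix_add:
  "map \<omega> [0..<m + n] = map \<omega> [0..<m] @ map ((shift ^^ m) \<omega>) [0..<n]"
  by (rule nth_equalityI) (auto simp: nth_append funpow_shift)

section \<open>Geometry of the cells\<close>

locale homothetic_pcf =
  fixes \<rho> :: real and N :: nat and b :: "nat \<Rightarrow> 'a::euclidean_space"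
    and F :: "nat \<Rightarrow> 'a \<Rightarrow> 'a" and K :: "'a set"
  assumes rho: "0 < \<rho>" "\<rho> < 1"
    and F_def: "F = (\<lambda>i. homothety \<rho> (b i))"
    and self_similar: "self_similar_set F N K"
    and connected: "connected K"
    and pcf: "pcf F N K"
    and card_boundary: "2 \<le> card (boundary F N K)"
begin

abbreviation "V\<^sub>0 \<equiv> boundary F N K"
abbreviation "cell w \<equiv> word_map F w ` K"

lemma compact_K: "compact K" and K_nonempty: "K \<noteq> {}" and K_eq: "K = (\<Union>i\<in>{1..N}. F i ` K)"
  using self_similar by (auto simp: self_similar_set_def)

lemma N_pos: "0 < N"
  using K_eq K_nonempty by (cases N) auto

lemma word_map_affine: "word_map F w x = \<rho> ^ length w *\<^sub>R x + word_map F w 0"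
  unfolding F_def by (rule word_map_homothety)

lemma word_map_diff: "word_map F w x - word_map F w y = \<rho> ^ length w *\<^sub>R (x - y)"
  by (subst word_map_affine[of w x], subst word_map_affine[of w y]) (simp add: algebra_simps)

lemma dist_word_map: "dist (word_map F w x) (word_map F w y) = \<rho> ^ length w * dist x y"
  using rho by (simp add: dist_norm word_map_diff)

lemma word_map_eq_iff [simp]: "word_map F w x = word_map F w y \<longleftrightarrow> x = y"
  using dist_word_map[of w x y] rho by (metis dist_eq_0_iff mult_eq_0_iff power_eq_0_iff less_irrefl)

lemma inj_on_word_map: "inj_on (word_map F w) A"
  by (simp add: inj_on_def)

lemma continuous_on_word_map [continuous_intros]: "continuous_on A (word_map F w)"
proof (rule continuous_on_eq)
  show "continuous_on A (\<lambda>x. \<rho> ^ length w *\<^sub>R x + word_map F w 0)"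
    by (intro continuous_intros)
qed (metis word_map_affine)

lemma K_eq_Union_cells: "K = (\<Union>w\<in>words N n. cell w)"
proof (induction n)
  case (Suc n)
  have cell_Cons: "cell (i # w) = F i ` cell w" for i w
    by (simp add: image_comp)
  have "(\<Union>w\<in>words N (Suc n). cell w) = (\<Union>i\<in>{1..N}. \<Union>w\<in>words N n. cell (i # w))"
  proof (intro equalityI UN_least)
    fix w assume "w \<in> words N (Suc n)"
    then obtain v i where "w = i # v" "v \<in> words N n" "i \<in> {1..N}"
      by (rule words_Suc_ConsE)
    then show "cell w \<subseteq> (\<Union>i\<in>{1..N}. \<Union>w\<in>words N n. cell (i # w))" by blast
  next
    fix i v assume "i \<in> {1..N}" "v \<in> words N n"
    then have "i # v \<in> words N (Suc n)" by (auto simp: words_def)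
    then show "cell (i # v) \<subseteq> (\<Union>w\<in>words N (Suc n). cell w)" by (rule UN_upper)
  qed
  also have "\<dots> = (\<Union>i\<in>{1..N}. F i ` (\<Union>w\<in>words N n. cell w))"
    unfolding cell_Cons image_UN ..
  also have "\<dots> = K"
    using K_eq Suc by simp
  finally show ?case ..
qed simp

lemma word_map_in_K: "w \<in> words N n \<Longrightarrow> x \<in> K \<Longrightarrow> word_map F w x \<in> K"
  using K_eq_Union_cells[of n] by blast

lemma point_in_cell:
  assumes "x \<in> K"
  obtains w y where "w \<in> words N n" "y \<in> K" "x = word_map F w y"
  using assms K_eq_Union_cells[of n] by blast

lemma compact_cell: "compact (cell w)"
  using compact_K by (intro compact_continuous_image continuous_intros)

lemma K_diameter:
  obtains D where "D > 0" "\<And>x y. x \<in> K \<Longrightarrow> y \<in> K \<Longrightarrow> dist x y < D"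
proof -
  obtain e where e: "\<And>x y. x \<in> K \<Longrightarrow> y \<in> K \<Longrightarrow> dist x y \<le> e"
    using compact_imp_bounded[OF compact_K] unfolding bounded_two_points by blast
  show thesis
    by (rule that[of "\<bar>e\<bar> + 1"]) (use e in \<open>force+\<close>)
qed

text \<open>
  Uniform over all words of a level, since every cell of level \<open>n\<close> is a copy of \<open>K\<close> scaled by \<open>\<rho>\<^sup>n\<close>.
\<close>

lemma cells_shrink:
  assumes "0 < e"
  obtains n0 where
    "\<And>n w x y. n \<ge> n0 \<Longrightarrow> w \<in> words N n \<Longrightarrow> x \<in> cell w \<Longrightarrow> y \<in> cell w \<Longrightarrow> dist x y < e"
proof -
  obtain D where D: "D > 0" "\<And>x y. x \<in> K \<Longrightarrow> y \<in> K \<Longrightarrow> dist x y < D"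
    using K_diameter by blast
  have "(\<lambda>n. \<rho> ^ n * D) \<longlonglongrightarrow> 0 * D"
    using rho by (intro tendsto_intros LIMSEQ_power_zero) auto
  then have "eventually (\<lambda>n. \<rho> ^ n * D < e) sequentially"
    using assms by (simp add: order_tendsto_iff)
  then obtain n0 where n0: "\<And>n. n \<ge> n0 \<Longrightarrow> \<rho> ^ n * D < e"
    by (auto simp: eventually_sequentially)
  show thesis
  proof (rule that)
    fix n w x y assume *: "n \<ge> n0" "w \<in> words N n" "x \<in> cell w" "y \<in> cell w"
    then obtain x' y' where xy: "x = word_map F w x'" "y = word_map F w y'" "x' \<in> K" "y' \<in> K"
      by blast
    have "dist x y = \<rho> ^ n * dist x' y'"
      using * xy by (simp add: dist_word_map length_words)
    also have "\<dots> \<le> \<rho> ^ n * D"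
      using D(2)[OF xy(3,4)] rho by (intro mult_left_mono) auto
    finally show "dist x y < e" using n0[OF *(1)] by simp
  qed
qed

subsection \<open>The coding map\<close>

lemma cell_prefix_mono: "\<omega> \<in> infinite_words N \<Longrightarrow> m \<le> n \<Longrightarrow>
    cell (map \<omega> [0..<n]) \<subseteq> cell (map \<omega> [0..<m])"
proof -
  assume \<omega>: "\<omega> \<in> infinite_words N" and "m \<le> n"
  then have *: "map \<omega> [0..<n] = map \<omega> [0..<m] @ map ((shift ^^ m) \<omega>) [0..<n - m]"
    using prefix_add[of \<omega> m "n - m"] by simp
  show ?thesis
    unfolding * using word_map_in_K[OF prefix_in_words[OF shift_infinite_words[OF \<omega>]]]
    by (auto simp: word_map_append)
qed

lemma Inter_cells:
  assumes \<omega>: "\<omega> \<in> infinite_words N"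
  shows "(\<Inter>n. cell (map \<omega> [0..<n])) = {coding F K \<omega>}"
proof -
  have "(\<Inter>n. cell (map \<omega> [0..<n])) \<noteq> {}"
    using compact_cell K_nonempty cell_prefix_mono[OF \<omega>] by (intro compact_nest) auto
  then obtain x where x: "x \<in> (\<Inter>n. cell (map \<omega> [0..<n]))" by blast
  have "y = x" if y: "y \<in> (\<Inter>n. cell (map \<omega> [0..<n]))" for y
  proof (rule ccontr)
    assume "y \<noteq> x"
    then obtain n0 where "\<And>n w x' y'. n \<ge> n0 \<Longrightarrow> w \<in> words N n \<Longrightarrow> x' \<in> cell w \<Longrightarrow> y' \<in> cell w \<Longrightarrow>
        dist x' y' < dist y x"
      using cells_shrink[of "dist y x"] by (metis zero_less_dist_iff)
    from this[of n0 "map \<omega> [0..<n0]" y x] show False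
      using x y prefix_in_words[OF \<omega>] by blast
  qed
  with x have "(\<Inter>n. cell (map \<omega> [0..<n])) = {x}" by blast
  then show ?thesis unfolding coding_def by simp
qed

lemma coding_eqI:
  assumes "\<omega> \<in> infinite_words N" "\<And>n. x \<in> cell (map \<omega> [0..<n])"
  shows "coding F K \<omega> = x"
proof -
  have "x \<in> (\<Inter>n. cell (map \<omega> [0..<n]))"
    using assms(2) by (rule INT_I)
  then show ?thesis unfolding Inter_cells[OF assms(1)] by simp
qed

lemma coding_in_cell:
  assumes "\<omega> \<in> infinite_words N"
  shows "coding F K \<omega> \<in> cell (map \<omega> [0..<n])"
proof -
  have "coding F K \<omega> \<in> (\<Inter>n. cell (map \<omega> [0..<n]))"
    unfolding Inter_cells[OF assms] by simp
  then show ?thesis by (rule INT_E) auto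
qed

lemma coding_in_K: "\<omega> \<in> infinite_words N \<Longrightarrow> coding F K \<omega> \<in> K"
  using coding_in_cell[of \<omega> 0] by simp

text \<open>
  Self-similarity of the coding map: deleting the first \<open>m\<close> letters of an address undoes \<open>F\<^sub>w\<close>, \<open>w\<close> being
  the deleted word.
\<close>

lemma coding_shift:
  assumes \<omega>: "\<omega> \<in> infinite_words N"
  shows "coding F K \<omega> = word_map F (map \<omega> [0..<m]) (coding F K ((shift ^^ m) \<omega>))"
proof (rule coding_eqI[OF \<omega>])
  fix n
  have "coding F K ((shift ^^ m) \<omega>) \<in> cell (map ((shift ^^ m) \<omega>) [0..<n])"
    using coding_in_cell shift_infinite_words[OF \<omega>] by blast
  then have "word_map F (map \<omega> [0..<m]) (coding F K ((shift ^^ m) \<omega>)) \<in> cell (map \<omega> [0..<m + n])"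
    by (auto simp: prefix_add word_map_append)
  then show "word_map F (map \<omega> [0..<m]) (coding F K ((shift ^^ m) \<omega>)) \<in> cell (map \<omega> [0..<n])"
    using cell_prefix_mono[OF \<omega>, of n "m + n"] by auto
qed

lemma ex_coding:
  assumes "x \<in> K"
  obtains \<omega> where "\<omega> \<in> infinite_words N" "coding F K \<omega> = x"
proof -
  have "\<forall>y\<in>K. \<exists>i z. i \<in> {1..N} \<and> z \<in> K \<and> y = F i z"
    using K_eq by blast
  then obtain i z where iz: "\<And>y. y \<in> K \<Longrightarrow> i y \<in> {1..N} \<and> z y \<in> K \<and> y = F (i y) (z y)"
    by metis
  define \<omega> where "\<omega> = (\<lambda>n. i ((z ^^ n) x))"
  have z: "(z ^^ n) x \<in> K" for n
    using assms iz by (induction n) auto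
  have \<omega>: "\<omega> \<in> infinite_words N"
    using iz z by (auto simp: infinite_words_def \<omega>_def)
  have "x = word_map F (map \<omega> [0..<n]) ((z ^^ n) x)" for n
  proof (induction n)
    case (Suc n)
    have "(z ^^ n) x = F (\<omega> n) ((z ^^ Suc n) x)"
      using iz[OF z[of n]] by (simp add: \<omega>_def)
    then show ?case
      using Suc by (simp add: word_map_append)
  qed simp
  then have "coding F K \<omega> = x"
    using z by (intro coding_eqI[OF \<omega>]) blast
  with \<omega> show thesis by (rule that)
qed

subsection \<open>Intersections of cells\<close>

lemma finite_boundary [simp]: "finite V\<^sub>0"
  using pcf by (simp add: boundary_def pcf_def)

lemma boundary_nonempty: "V\<^sub>0 \<noteq> {}"
  using card_boundary by auto

lemma post_critical_infinite_words: "post_critical_set F N K \<subseteq> infinite_words N"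
  by (auto simp: post_critical_set_def critical_set_def shift_infinite_words)

lemma boundary_subset: "V\<^sub>0 \<subseteq> K"
  using post_critical_infinite_words coding_in_K by (auto simp: boundary_def)

lemma boundary_in_K: "p \<in> V\<^sub>0 \<Longrightarrow> p \<in> K"
  using boundary_subset by blast

text \<open>
  This is where post-criticality enters. At the first letter in which \<open>w\<close> and \<open>v\<close> differ, the common point
  lies in two different first-level cells. So if \<open>a\<close> is an address of \<open>y\<close>, the word \<open>w\<close> stripped of the
  common prefix and followed by \<open>a\<close> is a critical address, and its tail \<open>a\<close> is post-critical.
\<close>

lemma cell_meets_in_boundary:
  assumes "w \<in> words N n" "v \<in> words N n" "w \<noteq> v" "y \<in> K" "word_map F w y \<in> cell v"
  shows "y \<in> V\<^sub>0"
  using assms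
proof (induction n arbitrary: w v)
  case (Suc n)
  obtain i w' where w: "w = i # w'" "w' \<in> words N n" "i \<in> {1..N}"
    using Suc.prems(1) by (rule words_Suc_ConsE)
  obtain j v' where v: "v = j # v'" "v' \<in> words N n" "j \<in> {1..N}"
    using Suc.prems(2) by (rule words_Suc_ConsE)
  show ?case
  proof (cases "i = j")
    case True
    have "word_map F w' y \<in> cell v'"
    proof -
      obtain z where "z \<in> K" "word_map F [i] (word_map F w' y) = word_map F [i] (word_map F v' z)"
        using Suc.prems(5) w v True by auto
      then show ?thesis by (simp only: word_map_eq_iff) blast
    qed
    then show ?thesis
      using Suc.IH[of w' v'] Suc.prems w v True by blast
  next
    case False
    obtain a where a: "a \<in> infinite_words N" "coding F K a = y"
      using ex_coding[OF Suc.prems(4)] .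
    \<comment> \<open>An address of the common point that begins with \<open>w\<close>.\<close>
    define \<omega> where "\<omega> = (\<lambda>k. if k < Suc n then w ! k else a (k - Suc n))"
    have len: "length w = Suc n" "set w \<subseteq> {1..N}"
      using Suc.prems(1) by (auto simp: words_def)
    have "a k \<in> {1..N}" for k
      using a(1) unfolding infinite_words_def by blast
    then have "\<omega> k \<in> {1..N}" for k
      using len(1) subsetD[OF len(2) nth_mem[of k w]] unfolding \<omega>_def by simp
    then have \<omega>: "\<omega> \<in> infinite_words N"
      by (auto simp: infinite_words_def)
    have s: "(shift ^^ Suc n) \<omega> = a"
      unfolding funpow_shift by (auto simp: \<omega>_def)
    have "map \<omega> [0..<Suc n] = w"
      using len by (intro nth_equalityI) (auto simp: \<omega>_def nth_append simp del: upt_Suc)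
    with coding_shift[OF \<omega>, of "Suc n"] s a have c: "coding F K \<omega> = word_map F w y" by simp
    have "word_map F w y \<in> F i ` K"
      using w word_map_in_K[OF w(2)] Suc.prems(4) by auto
    moreover have "word_map F w y \<in> F j ` K"
      using v word_map_in_K[OF v(2)] Suc.prems(5) by auto
    ultimately have "coding F K \<omega> \<in> F (min i j) ` K \<inter> F (max i j) ` K"
      unfolding c min_def max_def by simp
    moreover have "max i j \<in> {1..N}" "min i j \<in> {1..<max i j}"
      using False w(3) v(3) by auto
    ultimately have "\<omega> \<in> critical_set F N K"
      using \<omega> unfolding critical_set_def by blast
    then have "a \<in> post_critical_set F N K"
      unfolding post_critical_set_def using s by (intro UN_I[of "Suc n"]) auto
    with a show ?thesis by (auto simp: boundary_def)
  qed
qed simp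

text \<open>
  Infinity of \<open>K\<close> is what makes different words of equal length have different maps: otherwise their cells
  would coincide, hence consist of finitely many vertices.
\<close>

lemma infinite_K: "infinite K"
proof
  assume "finite K"
  with connected K_nonempty obtain x where "K = {x}"
    using connected_finite_iff_sing by blast
  then have "card V\<^sub>0 \<le> 1"
    using card_mono[of "{x}" "V\<^sub>0"] boundary_subset by simp
  with card_boundary show False by simp
qed

lemma word_map_0_inj: "inj_on (\<lambda>w. word_map F w 0) (words N n)"
proof (rule inj_onI, rule ccontr)
  fix w v assume *: "w \<in> words N n" "v \<in> words N n" "word_map F w 0 = word_map F v 0" "w \<noteq> v"
  have "word_map F w x = word_map F v x" for x
    using * word_map_affine[of w x] word_map_affine[of v x] by (simp add: length_words)
  then have "K \<subseteq> V\<^sub>0"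
    using cell_meets_in_boundary[OF *(1,2,4)] by auto
  then show False
    using infinite_K finite_subset[of K "V\<^sub>0"] by simp
qed

text \<open>
  All maps \<open>F\<^sub>w\<close> of one level have the same linear part, so two cells that share a vertex differ by a
  translation from a finite set, up to scaling. Both the bound on neighbours and the separation of
  disjoint cells rest on this.
\<close>

lemma meeting_cells_translation:
  assumes "w \<in> words N n" "v \<in> words N n" "cell w \<inter> cell v \<noteq> {}"
  obtains p q where "p \<in> V\<^sub>0" "q \<in> V\<^sub>0" "word_map F w p = word_map F v q"
    "word_map F v 0 = word_map F w 0 + \<rho> ^ n *\<^sub>R (p - q)"
proof -
  have "\<exists>p\<in>V\<^sub>0. \<exists>q\<in>V\<^sub>0. word_map F w p = word_map F v q"
  proof (cases "w = v")
    case True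
    then show ?thesis using boundary_nonempty by blast
  next
    case False
    obtain y z where "y \<in> K" "z \<in> K" "word_map F w y = word_map F v z"
      using assms(3) by blast
    moreover from this have "y \<in> V\<^sub>0" "z \<in> V\<^sub>0"
      using cell_meets_in_boundary[OF assms(1,2) False]
        cell_meets_in_boundary[OF assms(2,1) False[symmetric]] by (metis imageI)+
    ultimately show ?thesis by blast
  qed
  then obtain p q where pq: "p \<in> V\<^sub>0" "q \<in> V\<^sub>0" "word_map F w p = word_map F v q" by blast
  have "\<rho> ^ n *\<^sub>R p + word_map F w 0 = \<rho> ^ n *\<^sub>R q + word_map F v 0"
    using pq(3) word_map_affine[of w p] word_map_affine[of v q] assms by (simp add: length_words)
  then have "word_map F v 0 = word_map F w 0 + \<rho> ^ n *\<^sub>R (p - q)"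
    by (simp add: algebra_simps)
  with pq show thesis by (rule that)
qed

lemma card_neighbours:
  assumes "w \<in> words N n"
  shows "card {v \<in> words N n. cell w \<inter> cell v \<noteq> {}} \<le> (card V\<^sub>0)\<^sup>2"
proof -
  let ?A = "{v \<in> words N n. cell w \<inter> cell v \<noteq> {}}"
  let ?g = "\<lambda>(p, q). word_map F w 0 + \<rho> ^ n *\<^sub>R (p - q)"
  have sub: "(\<lambda>v. word_map F v 0) ` ?A \<subseteq> ?g ` (V\<^sub>0 \<times> V\<^sub>0)"
  proof (rule image_subsetI)
    fix v assume "v \<in> ?A"
    then have "v \<in> words N n" "cell w \<inter> cell v \<noteq> {}" by simp_all
    with assms obtain p q where "p \<in> V\<^sub>0" "q \<in> V\<^sub>0"
      "word_map F v 0 = word_map F w 0 + \<rho> ^ n *\<^sub>R (p - q)"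
      using meeting_cells_translation by metis
    then show "word_map F v 0 \<in> ?g ` (V\<^sub>0 \<times> V\<^sub>0)" by force
  qed
  have "card ?A = card ((\<lambda>v. word_map F v 0) ` ?A)"
    using inj_on_subset[OF word_map_0_inj[of n], of ?A] by (simp add: card_image)
  also have "\<dots> \<le> card (?g ` (V\<^sub>0 \<times> V\<^sub>0))"
    by (rule card_mono[OF _ sub]) simp
  also have "\<dots> \<le> card (V\<^sub>0 \<times> V\<^sub>0)" by (intro card_image_le) auto
  finally show ?thesis by (simp add: card_cartesian_product power2_eq_square)
qed

text \<open>
  Go up from two disjoint cells until their ancestors meet. One level below, the two cells are disjoint
  but their parents meet, so up to scaling they are \<open>K\<close> and one of finitely many translates of \<open>K\<close>
  disjoint from it; \<open>c\<close> is the least distance that occurs. Subcells are at least as far apart.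
\<close>

lemma disjoint_cells_separated:
  obtains c where "0 < c" "\<And>n w v x y. w \<in> words N n \<Longrightarrow> v \<in> words N n \<Longrightarrow> cell w \<inter> cell v = {} \<Longrightarrow>
    x \<in> cell w \<Longrightarrow> y \<in> cell v \<Longrightarrow> c * \<rho> ^ n \<le> dist x y"
proof -
  \<comment> \<open>The normalized translations between children of two parents that meet.\<close>
  define T where "T = (\<lambda>((p, q), (i, j)). (1 / \<rho>) *\<^sub>R (p - q + (1 - \<rho>) *\<^sub>R (b j - b i))) `
    ((V\<^sub>0 \<times> V\<^sub>0) \<times> ({1..N} \<times> {1..N}))"
  have finT: "finite T"
    unfolding T_def by simp
  have "\<exists>c>0. K \<inter> (\<lambda>y. y + t) ` K = {} \<longrightarrow> (\<forall>x\<in>K. \<forall>y\<in>K. c \<le> dist x (y + t))" for t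
  proof (cases "K \<inter> (\<lambda>y. y + t) ` K = {}")
    case True
    have c: "compact ((\<lambda>y. y + t) ` K)"
      using compact_K by (intro compact_continuous_image continuous_intros)
    have "0 < setdist K ((\<lambda>y. y + t) ` K)"
      using setdist_gt_0_compact_closed[OF compact_K compact_imp_closed[OF c]] True K_nonempty by simp
    moreover have "\<forall>x\<in>K. \<forall>y\<in>K. setdist K ((\<lambda>y. y + t) ` K) \<le> dist x (y + t)"
      by (auto intro: setdist_le_dist)
    ultimately show ?thesis by blast
  qed (auto intro: exI[of _ 1])
  then obtain g where g: "\<And>t. g t > 0"
    "\<And>t x y. K \<inter> (\<lambda>y. y + t) ` K = {} \<Longrightarrow> x \<in> K \<Longrightarrow> y \<in> K \<Longrightarrow> g t \<le> dist x (y + t)"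
    by metis
  define c where "c = Min (insert 1 (g ` T))"
  have c: "0 < c" "\<And>t. t \<in> T \<Longrightarrow> c \<le> g t"
    unfolding c_def using finT g(1) by (auto simp: Min_gr_iff)
  have "c * \<rho> ^ n \<le> dist x y" if "w \<in> words N n" "v \<in> words N n" "cell w \<inter> cell v = {}"
    "x \<in> cell w" "y \<in> cell v" for n w v x y
    using that
  proof (induction n arbitrary: w v)
    case 0
    then show ?case using K_nonempty by auto
  next
    case (Suc n)
    obtain w' i where w: "w = w' @ [i]" "w' \<in> words N n" "i \<in> {1..N}"
      using Suc.prems(1) by (rule words_SucE)
    obtain v' j where v: "v = v' @ [j]" "v' \<in> words N n" "j \<in> {1..N}"
      using Suc.prems(2) by (rule words_SucE)
    have Fi: "F k z \<in> K" if "k \<in> {1..N}" "z \<in> K" for k z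
      using K_eq that by blast
    have sub: "x \<in> cell w'" "y \<in> cell v'"
      using Suc.prems(4,5) w v Fi by (auto simp: word_map_append)
    show ?case
    proof (cases "cell w' \<inter> cell v' = {}")
      case True
      have "c * \<rho> ^ Suc n \<le> c * \<rho> ^ n"
        using c rho by (simp add: mult_le_cancel_left power_le_one_iff)
      also have "\<dots> \<le> dist x y"
        using Suc.IH[OF w(2) v(2) True sub] .
      finally show ?thesis .
    next
      case False
      then obtain p q where pq: "p \<in> V\<^sub>0" "q \<in> V\<^sub>0"
        "word_map F v' 0 = word_map F w' 0 + \<rho> ^ n *\<^sub>R (p - q)"
        using meeting_cells_translation[OF w(2) v(2)] by metis
      define t where "t = (1 / \<rho>) *\<^sub>R (p - q + (1 - \<rho>) *\<^sub>R (b j - b i))"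
      have "t \<in> T"
        unfolding T_def t_def using pq w v by force
      have last: "word_map F (u @ [k]) 0 = word_map F u 0 + (\<rho> ^ length u * (1 - \<rho>)) *\<^sub>R b k" for u k
        using word_map_affine[of u "F k 0"]
        by (simp add: word_map_append F_def homothety_def algebra_simps)
      have v0: "word_map F v 0 = word_map F w 0 + \<rho> ^ Suc n *\<^sub>R t"
        using rho pq(3) w v by (simp add: last t_def length_words algebra_simps)
      have vt: "word_map F v z = word_map F w (z + t)" for z
        using word_map_affine[of v z] word_map_affine[of w "z + t"] v0
          length_words[OF Suc.prems(1)] length_words[OF Suc.prems(2)] by (simp add: algebra_simps)
      have disj: "K \<inter> (\<lambda>z. z + t) ` K = {}"
        using Suc.prems(3) by (auto simp: vt)
      obtain x' y' where xy: "x = word_map F w x'" "y = word_map F v y'" "x' \<in> K" "y' \<in> K"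
        using Suc.prems(4,5) by blast
      have "dist x y = \<rho> ^ Suc n * dist x' (y' + t)"
        using xy length_words[OF Suc.prems(1)] by (simp add: vt dist_word_map)
      moreover have "c \<le> dist x' (y' + t)"
        using c(2)[OF \<open>t \<in> T\<close>] g(2)[OF disj xy(3,4)] by simp
      ultimately show ?thesis
        using rho by (simp add: mult.commute)
    qed
  qed
  with c(1) show thesis by (rule that)
qed

section \<open>Energies of cells\<close>

text \<open>
  The sum over image vertices may be taken over \<open>V\<^sub>0\<close> because the maps \<open>F\<^sub>w\<close> are injective.
\<close>

lemma primal_energy_eq:
  "primal_energy F N K n u = (\<Sum>w\<in>words N n. (1/2) *
     (\<Sum>p\<in>V\<^sub>0. \<Sum>q\<in>V\<^sub>0 - {p}. \<bar>u (word_map F w p) - u (word_map F w q)\<bar>\<^sup>2))"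
proof -
  have "(\<Sum>x\<in>word_map F w ` V\<^sub>0. \<Sum>y\<in>word_map F w ` V\<^sub>0 - {x}. \<bar>u x - u y\<bar>\<^sup>2)
      = (\<Sum>p\<in>V\<^sub>0. \<Sum>q\<in>V\<^sub>0 - {p}. \<bar>u (word_map F w p) - u (word_map F w q)\<bar>\<^sup>2)" for w
  proof -
    have "word_map F w ` V\<^sub>0 - {word_map F w p} = word_map F w ` (V\<^sub>0 - {p})" for p
      by auto
    then show ?thesis
      by (simp add: sum.reindex inj_on_word_map)
  qed
  then show ?thesis
    unfolding primal_energy_def by simp
qed

text \<open>
  The energy is additive over cells; this lets bounds on \<open>V\<^sub>0\<close> be transported into every cell.
\<close>

lemma primal_energy_add:
  "primal_energy F N K (n + m) u = (\<Sum>w\<in>words N n. primal_energy F N K m (u \<circ> word_map F w))"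
  unfolding primal_energy_eq sum_words_add by (simp add: word_map_append)

lemma primal_energy_cong:
  assumes "\<And>w p. w \<in> words N n \<Longrightarrow> p \<in> V\<^sub>0 \<Longrightarrow> u (word_map F w p) = v (word_map F w p)"
  shows "primal_energy F N K n u = primal_energy F N K n v"
  unfolding primal_energy_eq using assms by (intro sum.cong arg_cong2[of _ _ _ _ "(*)"] refl) auto

text \<open>
  The Markov property, needed to clip a minimizer to the range of its boundary data.
\<close>

lemma primal_energy_lipschitz:
  assumes "\<And>x y. \<bar>\<phi> x - \<phi> y\<bar> \<le> \<bar>x - y\<bar>"
  shows "primal_energy F N K n (\<phi> \<circ> u) \<le> primal_energy F N K n u"
  unfolding primal_energy_eq using assms
  by (intro sum_mono mult_left_mono power_mono) auto

lemma primal_energy_nonneg: "0 \<le> primal_energy F N K n u"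
  unfolding primal_energy_eq by (intro sum_nonneg mult_nonneg_nonneg) auto

end

section \<open>The self-similar measure\<close>

locale homothetic_pcf_measure = homothetic_pcf +
  fixes \<mu> :: "'a measure" and \<alpha> :: real
  assumes mu: "self_similar_measure F N K \<mu>"
    and alpha: "\<alpha> = ln (real N) / \<bar>ln \<rho>\<bar>"
begin

lemma rho_powr_alpha: "\<rho> powr \<alpha> = 1 / real N"
proof -
  have "\<alpha> * ln \<rho> = - ln (real N)"
    using rho by (simp add: alpha)
  then show ?thesis
    using rho N_pos by (simp add: powr_def exp_minus inverse_eq_divide)
qed

lemma N_power_eq: "real N ^ n = (\<rho> ^ n) powr (- \<alpha>)"
proof -
  have "(\<rho> ^ n) powr (- \<alpha>) = (\<rho> powr (- \<alpha>)) ^ n"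
    using rho by (simp add: powr_powr mult.commute flip: powr_realpow)
  then show ?thesis
    by (simp add: powr_minus rho_powr_alpha)
qed

lemma sets_mu: "sets \<mu> = sets (restrict_space borel K)"
  and emeasure_mu_K: "emeasure \<mu> K = 1"
  using mu by (auto simp: self_similar_measure_def)

lemma space_mu [simp]: "space \<mu> = K"
  using sets_eq_imp_space_eq[OF sets_mu] by (simp add: space_restrict_space)

sublocale finite_measure \<mu>
  by standard (simp add: emeasure_mu_K)

lemma measurable_word_map:
  assumes "w \<in> words N n"
  shows "word_map F w \<in> measurable \<mu> \<mu>"
proof -
  have "word_map F w \<in> borel_measurable borel"
    by (intro borel_measurable_continuous_onI continuous_on_word_map)
  then have "word_map F w \<in> measurable (restrict_space borel K) (restrict_space borel K)"
    using word_map_in_K[OF assms] by (intro measurable_restrict_space3) auto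
  then show ?thesis
    using measurable_cong_sets[OF sets_mu sets_mu] by blast
qed

lemma measurable_F: "i \<in> {1..N} \<Longrightarrow> F i \<in> measurable \<mu> \<mu>"
  using measurable_word_map[of "[i]" 1] by (simp add: words_def)

lemma emeasure_self_similar:
  assumes "A \<in> sets \<mu>"
  shows "of_nat N * emeasure \<mu> A = (\<Sum>i\<in>{1..N}. emeasure \<mu> (F i -` A \<inter> K))"
proof -
  have "real N * measure \<mu> A = (\<Sum>i\<in>{1..N}. measure \<mu> (F i -` A \<inter> K))"
    using mu assms N_pos by (simp add: self_similar_measure_def)
  then have "ennreal (real N * measure \<mu> A) = ennreal (\<Sum>i\<in>{1..N}. measure \<mu> (F i -` A \<inter> K))"
    by simp
  then show ?thesis
    by (simp add: ennreal_mult emeasure_eq_measure ennreal_of_nat_eq_real_of_nat flip: sum_ennreal)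
qed

text \<open>
  The defining identity of the measure, extended from sets to functions by the standard induction over
  nonnegative measurable functions.
\<close>

lemma nn_integral_self_similar:
  assumes "f \<in> borel_measurable \<mu>"
  shows "of_nat N * (\<integral>\<^sup>+x. f x \<partial>\<mu>) = (\<Sum>i\<in>{1..N}. \<integral>\<^sup>+x. f (F i x) \<partial>\<mu>)"
  using assms
proof (induction f rule: borel_measurable_induct)
  case (cong f g)
  have "(\<integral>\<^sup>+x. f (F i x) \<partial>\<mu>) = (\<integral>\<^sup>+x. g (F i x) \<partial>\<mu>)" if "i \<in> {1..N}" for i
    using cong(3) measurable_space[OF measurable_F[OF that]] by (intro nn_integral_cong) simp
  moreover have "(\<integral>\<^sup>+x. f x \<partial>\<mu>) = (\<integral>\<^sup>+x. g x \<partial>\<mu>)"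
    using cong(3) by (intro nn_integral_cong) simp
  ultimately show ?case
    using cong(4) by simp
next
  case (set A)
  have "(\<integral>\<^sup>+x. indicator A (F i x) \<partial>\<mu>) = emeasure \<mu> (F i -` A \<inter> K)" if "i \<in> {1..N}" for i
  proof -
    have "(\<integral>\<^sup>+x. indicator A (F i x) \<partial>\<mu>) = (\<integral>\<^sup>+x. indicator (F i -` A \<inter> K) x \<partial>\<mu>)"
      by (intro nn_integral_cong) (simp add: indicator_def)
    also have "\<dots> = emeasure \<mu> (F i -` A \<inter> K)"
      using measurable_sets[OF measurable_F[OF that] set] by simp
    finally show ?thesis .
  qed
  then show ?case
    using emeasure_self_similar[OF set] set by simp
next
  case (mult u c)
  have "(\<integral>\<^sup>+x. c * u (F i x) \<partial>\<mu>) = c * (\<integral>\<^sup>+x. u (F i x) \<partial>\<mu>)" if "i \<in> {1..N}" for i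
    using measurable_compose[OF measurable_F[OF that] mult(2)] by (rule nn_integral_cmult)
  moreover have "(\<integral>\<^sup>+x. c * u x \<partial>\<mu>) = c * (\<integral>\<^sup>+x. u x \<partial>\<mu>)"
    using mult(2) by (rule nn_integral_cmult)
  ultimately show ?case
    using mult(4) by (simp add: mult.left_commute flip: sum_distrib_left)
next
  case (add u v)
  have "(\<integral>\<^sup>+x. v (F i x) + u (F i x) \<partial>\<mu>) = (\<integral>\<^sup>+x. v (F i x) \<partial>\<mu>) + (\<integral>\<^sup>+x. u (F i x) \<partial>\<mu>)"
    if "i \<in> {1..N}" for i
    using measurable_compose[OF measurable_F[OF that] add(1)]
      measurable_compose[OF measurable_F[OF that] add(3)] by (intro nn_integral_add)
  moreover have "(\<integral>\<^sup>+x. v x + u x \<partial>\<mu>) = (\<integral>\<^sup>+x. v x \<partial>\<mu>) + (\<integral>\<^sup>+x. u x \<partial>\<mu>)"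
    using add by (intro nn_integral_add)
  ultimately show ?case
    using add by (simp add: sum.distrib distrib_left)
next
  case (seq U)
  have inc: "incseq (\<lambda>k x. U k (F i x))" for i
    using seq(3) by (simp add: incseq_def le_fun_def)
  have 1: "(\<integral>\<^sup>+x. (SUP k. U k x) \<partial>\<mu>) = (SUP k. \<integral>\<^sup>+x. U k x \<partial>\<mu>)"
    using seq by (intro nn_integral_monotone_convergence_SUP)
  have 2: "(\<integral>\<^sup>+x. (SUP k. U k (F i x)) \<partial>\<mu>) = (SUP k. \<integral>\<^sup>+x. U k (F i x) \<partial>\<mu>)" if "i \<in> {1..N}" for i
    using measurable_compose[OF measurable_F[OF that] seq(1)] inc
    by (intro nn_integral_monotone_convergence_SUP)
  have inc': "incseq (\<lambda>k. \<integral>\<^sup>+x. U k (F i x) \<partial>\<mu>)" for i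
    using seq(3) by (auto simp: incseq_def le_fun_def intro!: nn_integral_mono)
  have "of_nat N * (\<integral>\<^sup>+x. (SUP k. U k x) \<partial>\<mu>) = (SUP k. of_nat N * (\<integral>\<^sup>+x. U k x \<partial>\<mu>))"
    unfolding 1 by (simp add: SUP_mult_left_ennreal)
  also have "\<dots> = (SUP k. \<Sum>i\<in>{1..N}. \<integral>\<^sup>+x. U k (F i x) \<partial>\<mu>)"
    using seq by simp
  also have "\<dots> = (\<Sum>i\<in>{1..N}. SUP k. \<integral>\<^sup>+x. U k (F i x) \<partial>\<mu>)"
    using inc' by (intro ennreal_SUP_sum)
  also have "\<dots> = (\<Sum>i\<in>{1..N}. \<integral>\<^sup>+x. (SUP k. U k (F i x)) \<partial>\<mu>)"
    using 2 by simp
  finally show ?case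
    by (simp add: image_comp)
qed

lemma nn_integral_words:
  assumes "f \<in> borel_measurable \<mu>"
  shows "of_nat N ^ n * (\<integral>\<^sup>+x. f x \<partial>\<mu>) = (\<Sum>w\<in>words N n. \<integral>\<^sup>+x. f (word_map F w x) \<partial>\<mu>)"
proof (induction n)
  case (Suc n)
  have "of_nat N ^ Suc n * (\<integral>\<^sup>+x. f x \<partial>\<mu>)
      = (\<Sum>w\<in>words N n. of_nat N * (\<integral>\<^sup>+x. f (word_map F w x) \<partial>\<mu>))"
    using Suc by (simp add: mult.assoc flip: sum_distrib_left)
  also have "\<dots> = (\<Sum>w\<in>words N n. \<Sum>i\<in>{1..N}. \<integral>\<^sup>+x. f (word_map F w (F i x)) \<partial>\<mu>)"
    by (intro sum.cong refl nn_integral_self_similar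
        measurable_compose[OF measurable_word_map assms])
  finally show ?case
    by (simp add: sum_words_Suc word_map_append)
qed simp

text \<open>
  Double integrals split over all pairs of cells of a level. Working with the compositions
  \<open>g (F\<^sub>w x) (F\<^sub>v y)\<close> instead of integrals over \<open>F\<^sub>w(K) \<times> F\<^sub>v(K)\<close> avoids any discussion of the overlaps.
\<close>

lemma nn_integral_pair_words:
  assumes [measurable]: "case_prod g \<in> borel_measurable (\<mu> \<Otimes>\<^sub>M \<mu>)"
  shows "of_nat N ^ (2 * n) * (\<integral>\<^sup>+x. \<integral>\<^sup>+y. g x y \<partial>\<mu> \<partial>\<mu>)
    = (\<Sum>w\<in>words N n. \<Sum>v\<in>words N n. \<integral>\<^sup>+x. \<integral>\<^sup>+y. g (word_map F w x) (word_map F v y) \<partial>\<mu> \<partial>\<mu>)"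
proof -
  have inner [measurable]: "(\<lambda>x. \<integral>\<^sup>+y. g x y \<partial>\<mu>) \<in> borel_measurable \<mu>"
    by measurable
  have row: "of_nat N ^ n * (\<integral>\<^sup>+x. \<integral>\<^sup>+y. g (word_map F w x) y \<partial>\<mu> \<partial>\<mu>)
      = (\<Sum>v\<in>words N n. \<integral>\<^sup>+x. \<integral>\<^sup>+y. g (word_map F w x) (word_map F v y) \<partial>\<mu> \<partial>\<mu>)"
    if w: "w \<in> words N n" for w
  proof -
    note [measurable] = measurable_word_map[OF w]
    have "of_nat N ^ n * (\<integral>\<^sup>+x. \<integral>\<^sup>+y. g (word_map F w x) y \<partial>\<mu> \<partial>\<mu>)
        = (\<integral>\<^sup>+x. of_nat N ^ n * (\<integral>\<^sup>+y. g (word_map F w x) y \<partial>\<mu>) \<partial>\<mu>)"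
      by (rule nn_integral_cmult[symmetric]) measurable
    also have "\<dots> = (\<integral>\<^sup>+x. (\<Sum>v\<in>words N n. \<integral>\<^sup>+y. g (word_map F w x) (word_map F v y) \<partial>\<mu>) \<partial>\<mu>)"
    proof (rule nn_integral_cong)
      fix x assume "x \<in> space \<mu>"
      then have [measurable]: "word_map F w x \<in> space \<mu>"
        using word_map_in_K[OF w] by simp
      show "of_nat N ^ n * (\<integral>\<^sup>+y. g (word_map F w x) y \<partial>\<mu>)
          = (\<Sum>v\<in>words N n. \<integral>\<^sup>+y. g (word_map F w x) (word_map F v y) \<partial>\<mu>)"
        by (rule nn_integral_words) measurable
    qed
    also have "\<dots> = (\<Sum>v\<in>words N n. \<integral>\<^sup>+x. \<integral>\<^sup>+y. g (word_map F w x) (word_map F v y) \<partial>\<mu> \<partial>\<mu>)"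
    proof (rule nn_integral_sum)
      fix v assume v: "v \<in> words N n"
      note [measurable] = measurable_word_map[OF v]
      show "(\<lambda>x. \<integral>\<^sup>+y. g (word_map F w x) (word_map F v y) \<partial>\<mu>) \<in> borel_measurable \<mu>"
        by measurable
    qed
    finally show ?thesis .
  qed
  have "of_nat N ^ (2 * n) * (\<integral>\<^sup>+x. \<integral>\<^sup>+y. g x y \<partial>\<mu> \<partial>\<mu>)
      = of_nat N ^ n * (\<Sum>w\<in>words N n. \<integral>\<^sup>+x. \<integral>\<^sup>+y. g (word_map F w x) y \<partial>\<mu> \<partial>\<mu>)"
    using nn_integral_words[OF inner, of n] by (simp add: mult_2 power_add mult.assoc)
  then show ?thesis
    using row by (simp add: sum_distrib_left)
qed

text \<open>
  The square of the Besov seminorm is the supremum over \<open>0 < r < 1\<close> of this double integral times \<open>r\<^bsup>-\<alpha>-2\<sigma>\<^esup>\<close>.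
\<close>

definition near_diagonal_energy :: "('a \<Rightarrow> real) \<Rightarrow> real \<Rightarrow> ennreal" where
  "near_diagonal_energy u r = (\<integral>\<^sup>+x. (\<integral>\<^sup>+y\<in>ball x r. ennreal (\<bar>u x - u y\<bar>\<^sup>2) \<partial>\<mu>) \<partial>\<mu>)"

lemma continuous_on_K_measurable:
  fixes u :: "'a \<Rightarrow> 'b::topological_space"
  shows "continuous_on K u \<Longrightarrow> u \<in> borel_measurable \<mu>"
  using borel_measurable_continuous_on_restrict measurable_cong_sets[OF sets_mu refl] by blast

lemma near_diagonal_energy_words:
  assumes [measurable]: "u \<in> borel_measurable \<mu>"
  shows "of_nat N ^ (2 * n) * near_diagonal_energy u r
    = (\<Sum>w\<in>words N n. \<Sum>v\<in>words N n. \<integral>\<^sup>+x. \<integral>\<^sup>+y.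
        ennreal (\<bar>u (word_map F w x) - u (word_map F v y)\<bar>\<^sup>2)
          * indicator (ball (word_map F w x) r) (word_map F v y) \<partial>\<mu> \<partial>\<mu>)"
  unfolding near_diagonal_energy_def
proof (rule nn_integral_pair_words)
  have [measurable]: "(\<lambda>x. x) \<in> borel_measurable \<mu>"
    by (intro continuous_on_K_measurable continuous_on_id)
  have "(\<lambda>z. ennreal (\<bar>u (fst z) - u (snd z)\<bar>\<^sup>2) * indicator {z. dist (fst z) (snd z) < r} z)
      \<in> borel_measurable (\<mu> \<Otimes>\<^sub>M \<mu>)"
    by measurable
  then show "(\<lambda>(x, y). ennreal (\<bar>u x - u y\<bar>\<^sup>2) * indicator (ball x r) y) \<in> borel_measurable (\<mu> \<Otimes>\<^sub>M \<mu>)"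
    by (simp add: case_prod_beta indicator_def)
qed

text \<open>
  Two points of one cell of level \<open>m\<close> have distance less than \<open>\<rho>\<^sup>m D\<close>, so the diagonal pairs of cells
  only see the part of the double integral near the diagonal.
\<close>

lemma sum_cells_le_near_diagonal_energy:
  assumes [measurable]: "u \<in> borel_measurable \<mu>"
    and D: "\<And>x y. x \<in> K \<Longrightarrow> y \<in> K \<Longrightarrow> dist x y < D"
  shows "(\<Sum>v\<in>words N m. \<integral>\<^sup>+x. \<integral>\<^sup>+y. ennreal (\<bar>u (word_map F v x) - u (word_map F v y)\<bar>\<^sup>2) \<partial>\<mu> \<partial>\<mu>)
    \<le> of_nat N ^ (2 * m) * near_diagonal_energy u (\<rho> ^ m * D)"
  unfolding near_diagonal_energy_words[OF assms(1)]
proof (rule sum_mono)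
  fix w assume w: "w \<in> words N m"
  let ?I = "\<lambda>v. \<integral>\<^sup>+x. \<integral>\<^sup>+y. ennreal (\<bar>u (word_map F w x) - u (word_map F v y)\<bar>\<^sup>2)
          * indicator (ball (word_map F w x) (\<rho> ^ m * D)) (word_map F v y) \<partial>\<mu> \<partial>\<mu>"
  have "(\<integral>\<^sup>+x. \<integral>\<^sup>+y. ennreal (\<bar>u (word_map F w x) - u (word_map F w y)\<bar>\<^sup>2) \<partial>\<mu> \<partial>\<mu>) = ?I w"
  proof (intro nn_integral_cong)
    fix x y assume "x \<in> space \<mu>" "y \<in> space \<mu>"
    then have "dist (word_map F w x) (word_map F w y) < \<rho> ^ m * D"
      using D rho w by (simp add: dist_word_map length_words)
    then show "ennreal (\<bar>u (word_map F w x) - u (word_map F w y)\<bar>\<^sup>2)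
      = ennreal (\<bar>u (word_map F w x) - u (word_map F w y)\<bar>\<^sup>2)
          * indicator (ball (word_map F w x) (\<rho> ^ m * D)) (word_map F w y)"
      by simp
  qed
  also have "\<dots> \<le> (\<Sum>v\<in>words N m. ?I v)"
    using w by (intro member_le_sum) auto
  finally show "(\<integral>\<^sup>+x. \<integral>\<^sup>+y. ennreal (\<bar>u (word_map F w x) - u (word_map F w y)\<bar>\<^sup>2) \<partial>\<mu> \<partial>\<mu>)
    \<le> (\<Sum>v\<in>words N m. ?I v)" .
qed

text \<open>
  Conversely, if \<open>r\<close> is below the separation of disjoint cells, only pairs of meeting cells contribute.
  There \<open>u x - u y\<close> is split at a common point, and each cell occurs in boundedly many pairs.
\<close>

lemma near_diagonal_energy_le_oscillations:
  assumes [measurable]: "u \<in> borel_measurable \<mu>"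
    and sep: "\<And>w v x y. w \<in> words N n \<Longrightarrow> v \<in> words N n \<Longrightarrow> cell w \<inter> cell v = {} \<Longrightarrow>
      x \<in> cell w \<Longrightarrow> y \<in> cell v \<Longrightarrow> r \<le> dist x y"
    and osc: "\<And>w x y. w \<in> words N n \<Longrightarrow> x \<in> cell w \<Longrightarrow> y \<in> cell w \<Longrightarrow> \<bar>u x - u y\<bar> \<le> d w"
  shows "of_nat N ^ (2 * n) * near_diagonal_energy u r
    \<le> ennreal (4 * (real (card V\<^sub>0))\<^sup>2 * (\<Sum>w\<in>words N n. (d w)\<^sup>2))"
proof -
  let ?meet = "\<lambda>w v. cell w \<inter> cell v \<noteq> {}"
  let ?J = "\<lambda>w v. if ?meet w v then 2 * (d w)\<^sup>2 + 2 * (d v)\<^sup>2 else 0"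
  have pair: "(\<integral>\<^sup>+x. \<integral>\<^sup>+y. ennreal (\<bar>u (word_map F w x) - u (word_map F v y)\<bar>\<^sup>2)
          * indicator (ball (word_map F w x) r) (word_map F v y) \<partial>\<mu> \<partial>\<mu>) \<le> ennreal (?J w v)"
    (is "?I \<le> _") if w: "w \<in> words N n" and v: "v \<in> words N n" for w v
  proof -
    have "?I \<le> (\<integral>\<^sup>+x. \<integral>\<^sup>+y. ennreal (?J w v) \<partial>\<mu> \<partial>\<mu>)"
    proof (intro nn_integral_mono)
      fix x y assume xy: "x \<in> space \<mu>" "y \<in> space \<mu>"
      let ?x = "word_map F w x" and ?y = "word_map F v y"
      show "ennreal (\<bar>u ?x - u ?y\<bar>\<^sup>2) * indicator (ball ?x r) ?y \<le> ennreal (?J w v)"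
      proof (cases "?meet w v")
        case True
        then obtain z where z: "z \<in> cell w" "z \<in> cell v" by blast
        have "\<bar>u ?x - u z\<bar> \<le> d w" "\<bar>u z - u ?y\<bar> \<le> d v"
          using xy z by (auto intro!: osc w v)
        then have "\<bar>u ?x - u ?y\<bar>\<^sup>2 \<le> (d w + d v)\<^sup>2"
          by (intro power_mono) auto
        also have "\<dots> \<le> 2 * (d w)\<^sup>2 + 2 * (d v)\<^sup>2"
          using sum_squares_bound[of "d w" "d v"] by (simp add: power2_sum)
        finally show ?thesis
          using True by (simp add: indicator_def ennreal_leI del: ennreal_plus)
      next
        case False
        then have "r \<le> dist ?x ?y"
          using xy by (intro sep[OF w v]) auto
        then show ?thesis by simp
      qed
    qed
    also have "\<dots> = ennreal (?J w v)"
      by (simp add: emeasure_mu_K)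
    finally show ?thesis .
  qed
  have half: "(\<Sum>w\<in>words N n. \<Sum>v\<in>words N n. if ?meet w v then 2 * (d w)\<^sup>2 else 0)
      \<le> 2 * (real (card V\<^sub>0))\<^sup>2 * (\<Sum>w\<in>words N n. (d w)\<^sup>2)"
    unfolding sum_distrib_left
  proof (rule sum_mono)
    fix w assume w: "w \<in> words N n"
    have "(\<Sum>v\<in>words N n. if ?meet w v then 2 * (d w)\<^sup>2 else 0)
        = real (card {v \<in> words N n. ?meet w v}) * (2 * (d w)\<^sup>2)"
      by (simp add: sum.If_cases Int_def)
    also have "\<dots> \<le> (real (card V\<^sub>0))\<^sup>2 * (2 * (d w)\<^sup>2)"
      using card_neighbours[OF w] by (intro mult_right_mono) (auto simp flip: of_nat_power)
    finally show "(\<Sum>v\<in>words N n. if ?meet w v then 2 * (d w)\<^sup>2 else 0)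
        \<le> 2 * (real (card V\<^sub>0))\<^sup>2 * (d w)\<^sup>2" by simp
  qed
  have swap: "(\<Sum>w\<in>words N n. \<Sum>v\<in>words N n. if ?meet w v then 2 * (d v)\<^sup>2 else 0)
      = (\<Sum>w\<in>words N n. \<Sum>v\<in>words N n. if ?meet w v then 2 * (d w)\<^sup>2 else 0)"
    by (subst sum.swap) (simp add: Int_commute)
  have "of_nat N ^ (2 * n) * near_diagonal_energy u r \<le> (\<Sum>w\<in>words N n. \<Sum>v\<in>words N n. ennreal (?J w v))"
    unfolding near_diagonal_energy_words[OF assms(1)] by (intro sum_mono pair)
  also have "\<dots> = ennreal (\<Sum>w\<in>words N n. \<Sum>v\<in>words N n. ?J w v)"
    by (simp add: sum_ennreal sum_nonneg)
  also have "(\<Sum>w\<in>words N n. \<Sum>v\<in>words N n. ?J w v)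
      = (\<Sum>w\<in>words N n. \<Sum>v\<in>words N n. if ?meet w v then 2 * (d w)\<^sup>2 else 0)
        + (\<Sum>w\<in>words N n. \<Sum>v\<in>words N n. if ?meet w v then 2 * (d v)\<^sup>2 else 0)"
    unfolding sum.distrib[symmetric] by (intro sum.cong refl) auto
  also have "ennreal \<dots> \<le> ennreal (4 * (real (card V\<^sub>0))\<^sup>2 * (\<Sum>w\<in>words N n. (d w)\<^sup>2))"
    using half unfolding swap by (intro ennreal_leI) simp
  finally show ?thesis .
qed

end

section \<open>Energy bounds from the Besov seminorm\<close>

context homothetic_pcf_measure
begin

lemma near_diagonal_energy_le_besov:
  assumes fin: "besov_seminorm_sq \<mu> \<alpha> \<sigma> u < \<infinity>"
  obtains M where "0 \<le> M"
    "\<And>r. 0 < r \<Longrightarrow> r < 1 \<Longrightarrow> near_diagonal_energy u r \<le> ennreal (M * r powr (\<alpha> + 2 * \<sigma>))"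
proof -
  define M where "M = enn2real (besov_seminorm_sq \<mu> \<alpha> \<sigma> u)"
  have "near_diagonal_energy u r \<le> ennreal (M * r powr (\<alpha> + 2 * \<sigma>))" if r: "0 < r" "r < 1" for r
  proof -
    have "ennreal (r powr (- \<alpha> - 2 * \<sigma>)) * near_diagonal_energy u r \<le> besov_seminorm_sq \<mu> \<alpha> \<sigma> u"
      unfolding besov_seminorm_sq_def near_diagonal_energy_def using r by (intro SUP_upper) auto
    also have "\<dots> = ennreal M"
      using fin by (simp add: M_def)
    finally have le: "ennreal (r powr (- \<alpha> - 2 * \<sigma>)) * near_diagonal_energy u r \<le> ennreal M" .
    have one: "ennreal (r powr (\<alpha> + 2 * \<sigma>)) * ennreal (r powr (- \<alpha> - 2 * \<sigma>)) = 1"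
      using r by (simp flip: ennreal_mult powr_add)
    have "near_diagonal_energy u r
        = ennreal (r powr (\<alpha> + 2 * \<sigma>)) * (ennreal (r powr (- \<alpha> - 2 * \<sigma>)) * near_diagonal_energy u r)"
      unfolding mult.assoc[symmetric] one by simp
    also have "\<dots> \<le> ennreal (r powr (\<alpha> + 2 * \<sigma>)) * ennreal M"
      using le by (rule mult_left_mono) simp
    also have "\<dots> = ennreal (M * r powr (\<alpha> + 2 * \<sigma>))"
      by (simp add: ennreal_mult M_def mult.commute)
    finally show ?thesis .
  qed
  moreover have "0 \<le> M" by (simp add: M_def)
  ultimately show thesis using that[of M] by blast
qed

text \<open>
  Here the exponents combine: \<open>N\<^bsup>2m\<^esup> = \<rho>\<^bsup>-2\<alpha>m\<^esup>\<close> from splitting into cells, against \<open>\<rho>\<^bsup>(\<alpha>+2\<sigma>)m\<^esup>\<close> from the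
  seminorm at radius comparable to \<open>\<rho>\<^sup>m\<close>. Levels below \<open>m0\<close> are left out because the seminorm only looks
  at radii below \<open>1\<close>.
\<close>

lemma sum_cells_le_besov:
  assumes "u \<in> borel_measurable \<mu>" and fin: "besov_seminorm_sq \<mu> \<alpha> \<sigma> u < \<infinity>"
  obtains C m0 where "0 \<le> C" "\<And>m. m \<ge> m0 \<Longrightarrow>
    (\<Sum>v\<in>words N m. \<integral>\<^sup>+x. \<integral>\<^sup>+y. ennreal (\<bar>u (word_map F v x) - u (word_map F v y)\<bar>\<^sup>2) \<partial>\<mu> \<partial>\<mu>)
      \<le> ennreal (C * (\<rho> powr (2 * \<sigma> - \<alpha>)) ^ m)"
proof -
  obtain M where M: "0 \<le> M"
    "\<And>r. 0 < r \<Longrightarrow> r < 1 \<Longrightarrow> near_diagonal_energy u r \<le> ennreal (M * r powr (\<alpha> + 2 * \<sigma>))"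
    using near_diagonal_energy_le_besov[OF fin] by blast
  obtain D where D: "D > 0" "\<And>x y. x \<in> K \<Longrightarrow> y \<in> K \<Longrightarrow> dist x y < D"
    using K_diameter by blast
  have "(\<lambda>m. \<rho> ^ m * D) \<longlonglongrightarrow> 0 * D"
    using rho by (intro tendsto_intros LIMSEQ_power_zero) auto
  then have "eventually (\<lambda>m. \<rho> ^ m * D < 1) sequentially"
    by (simp add: order_tendsto_iff)
  then obtain m0 where m0: "\<And>m. m \<ge> m0 \<Longrightarrow> \<rho> ^ m * D < 1"
    by (auto simp: eventually_sequentially)
  define C where "C = M * D powr (\<alpha> + 2 * \<sigma>)"
  have "(\<Sum>v\<in>words N m. \<integral>\<^sup>+x. \<integral>\<^sup>+y. ennreal (\<bar>u (word_map F v x) - u (word_map F v y)\<bar>\<^sup>2) \<partial>\<mu> \<partial>\<mu>)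
      \<le> ennreal (C * (\<rho> powr (2 * \<sigma> - \<alpha>)) ^ m)" if "m \<ge> m0" for m
  proof -
    have pos: "0 < \<rho> ^ m" using rho by simp
    have "(\<Sum>v\<in>words N m. \<integral>\<^sup>+x. \<integral>\<^sup>+y. ennreal (\<bar>u (word_map F v x) - u (word_map F v y)\<bar>\<^sup>2) \<partial>\<mu> \<partial>\<mu>)
      \<le> of_nat N ^ (2 * m) * near_diagonal_energy u (\<rho> ^ m * D)"
      by (rule sum_cells_le_near_diagonal_energy[OF assms(1) D(2)])
    also have "\<dots> \<le> of_nat N ^ (2 * m) * ennreal (M * (\<rho> ^ m * D) powr (\<alpha> + 2 * \<sigma>))"
      using m0[OF that] D rho by (intro mult_left_mono M) auto
    also have "\<dots> = ennreal (real N ^ (2 * m) * (M * (\<rho> ^ m * D) powr (\<alpha> + 2 * \<sigma>)))"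
      using M(1) by (simp add: ennreal_mult ennreal_of_nat_eq_real_of_nat ennreal_power)
    also have "real N ^ (2 * m) * (M * (\<rho> ^ m * D) powr (\<alpha> + 2 * \<sigma>))
        = C * ((\<rho> ^ m) powr (- \<alpha>) * (\<rho> ^ m) powr (- \<alpha>) * (\<rho> ^ m) powr (\<alpha> + 2 * \<sigma>))"
    proof -
      have "real N ^ (2 * m) = (\<rho> ^ m) powr (- \<alpha>) * (\<rho> ^ m) powr (- \<alpha>)"
        unfolding N_power_eq[symmetric] by (simp add: mult_2 power_add)
      moreover have "(\<rho> ^ m * D) powr (\<alpha> + 2 * \<sigma>) = (\<rho> ^ m) powr (\<alpha> + 2 * \<sigma>) * D powr (\<alpha> + 2 * \<sigma>)"
        using D(1) rho by (simp add: powr_mult)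
      ultimately show ?thesis
        unfolding C_def by (simp only: mult_ac)
    qed
    also have "(\<rho> ^ m) powr (- \<alpha>) * (\<rho> ^ m) powr (- \<alpha>) * (\<rho> ^ m) powr (\<alpha> + 2 * \<sigma>)
        = (\<rho> ^ m) powr (2 * \<sigma> - \<alpha>)"
      by (simp flip: powr_add)
    also have "\<dots> = (\<rho> powr (2 * \<sigma> - \<alpha>)) ^ m"
      using rho by (simp add: powr_powr mult.commute flip: powr_realpow)
    finally show ?thesis .
  qed
  moreover have "0 \<le> C" by (simp add: C_def M(1))
  ultimately show thesis using that[of C m0] by blast
qed

text \<open>
  Jensen's inequality for the square, that is, nonnegativity of the variance of \<open>h\<close>.
\<close>

lemma square_diff_mean_le:
  fixes h :: "'a \<Rightarrow> real"
  assumes [measurable]: "h \<in> borel_measurable \<mu>" and bnd: "\<And>x. x \<in> K \<Longrightarrow> \<bar>h x\<bar> \<le> B"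
  shows "ennreal (\<bar>(\<integral>x. h x \<partial>\<mu>) - c\<bar>\<^sup>2) \<le> (\<integral>\<^sup>+x. ennreal (\<bar>h x - c\<bar>\<^sup>2) \<partial>\<mu>)"
proof -
  have one: "measure \<mu> K = 1"
    using emeasure_mu_K by (simp add: measure_def)
  have h [simp]: "integrable \<mu> h"
    using bnd by (intro integrable_const_bound[of _ B]) (auto intro!: AE_I2)
  define e where "e = (\<integral>x. h x \<partial>\<mu>)"
  have h2 [simp]: "integrable \<mu> (\<lambda>x. (h x)\<^sup>2)"
  proof (rule integrable_const_bound[of _ "B\<^sup>2"])
    show "AE x in \<mu>. norm ((h x)\<^sup>2) \<le> B\<^sup>2"
      using bnd by (intro AE_I2) (simp add: abs_le_square_iff[symmetric] order_trans[OF bnd])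
  qed measurable
  have sq: "(\<integral>x. (h x - k)\<^sup>2 \<partial>\<mu>) = (\<integral>x. (h x)\<^sup>2 \<partial>\<mu>) - 2 * k * e + k\<^sup>2"
    and int_sq: "integrable \<mu> (\<lambda>x. (h x - k)\<^sup>2)" for k
    by (simp_all add: power2_diff e_def one)
  have "0 \<le> (\<integral>x. (h x - e)\<^sup>2 \<partial>\<mu>)"
    by simp
  then have "(e - c)\<^sup>2 \<le> (\<integral>x. (h x - c)\<^sup>2 \<partial>\<mu>)"
    unfolding sq by (simp add: power2_eq_square algebra_simps)
  then have "ennreal ((e - c)\<^sup>2) \<le> ennreal (\<integral>x. (h x - c)\<^sup>2 \<partial>\<mu>)"
    by (rule ennreal_leI)
  also have "\<dots> = (\<integral>\<^sup>+x. ennreal ((h x - c)\<^sup>2) \<partial>\<mu>)"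
    by (rule nn_integral_eq_integral[symmetric]) (use int_sq in auto)
  finally show ?thesis by (simp add: e_def)
qed

definition cell_mean :: "('a \<Rightarrow> real) \<Rightarrow> nat list \<Rightarrow> real" where
  "cell_mean u w = (\<integral>x. u (word_map F w x) \<partial>\<mu>)"

lemma bounded_on_K:
  fixes u :: "'a \<Rightarrow> real"
  assumes "continuous_on K u"
  obtains B where "\<And>x. x \<in> K \<Longrightarrow> \<bar>u x\<bar> \<le> B"
proof -
  have "bounded (u ` K)"
    using assms compact_K by (intro compact_imp_bounded compact_continuous_image)
  then obtain B where "\<And>x. x \<in> K \<Longrightarrow> \<bar>u x\<bar> \<le> B"
    unfolding bounded_iff by auto
  then show thesis by (rule that)
qed

text \<open>
  Jensen's inequality is applied twice, once for the mean over the child and once for the mean over the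
  cell; the factor \<open>N\<close> is the price for enlarging the child to the whole cell.
\<close>

lemma cell_mean_child:
  assumes u: "continuous_on K u" and w: "w \<in> words N n" and i: "i \<in> {1..N}"
  shows "ennreal (\<bar>cell_mean u (w @ [i]) - cell_mean u w\<bar>\<^sup>2)
    \<le> of_nat N * (\<integral>\<^sup>+x. \<integral>\<^sup>+y. ennreal (\<bar>u (word_map F w x) - u (word_map F w y)\<bar>\<^sup>2) \<partial>\<mu> \<partial>\<mu>)"
proof -
  note [measurable] = continuous_on_K_measurable[OF u] measurable_word_map[OF w] measurable_F[OF i]
  obtain B where B: "\<And>x. x \<in> K \<Longrightarrow> \<bar>u x\<bar> \<le> B"
    using bounded_on_K[OF u] by blast
  have Fi: "F i x \<in> K" if "x \<in> K" for x
    using K_eq that i by blast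
  let ?g = "\<lambda>x. ennreal (\<bar>u (word_map F w x) - cell_mean u w\<bar>\<^sup>2)"
  have "ennreal (\<bar>cell_mean u (w @ [i]) - cell_mean u w\<bar>\<^sup>2) \<le> (\<integral>\<^sup>+x. ?g (F i x) \<partial>\<mu>)"
    unfolding cell_mean_def[of u "w @ [i]"] word_map_append word_map.simps id_def o_def
    by (rule square_diff_mean_le[where B = B]) (auto intro!: B word_map_in_K[OF w] Fi)
  also have "\<dots> \<le> (\<Sum>i\<in>{1..N}. \<integral>\<^sup>+x. ?g (F i x) \<partial>\<mu>)"
    using i by (intro member_le_sum[where f = "\<lambda>i. \<integral>\<^sup>+x. ?g (F i x) \<partial>\<mu>"]) auto
  also have "\<dots> = of_nat N * (\<integral>\<^sup>+x. ?g x \<partial>\<mu>)"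
    by (rule nn_integral_self_similar[symmetric]) measurable
  also have "\<dots> \<le> of_nat N * (\<integral>\<^sup>+x. \<integral>\<^sup>+y. ennreal (\<bar>u (word_map F w x) - u (word_map F w y)\<bar>\<^sup>2) \<partial>\<mu> \<partial>\<mu>)"
  proof (intro mult_left_mono nn_integral_mono)
    fix x
    have "ennreal (\<bar>cell_mean u w - u (word_map F w x)\<bar>\<^sup>2)
        \<le> (\<integral>\<^sup>+y. ennreal (\<bar>u (word_map F w y) - u (word_map F w x)\<bar>\<^sup>2) \<partial>\<mu>)"
      unfolding cell_mean_def
      by (rule square_diff_mean_le[where B = B]) (auto intro!: B word_map_in_K[OF w])
    then show "?g x \<le> (\<integral>\<^sup>+y. ennreal (\<bar>u (word_map F w x) - u (word_map F w y)\<bar>\<^sup>2) \<partial>\<mu>)"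
      by (simp add: abs_minus_commute)
  qed simp
  finally show ?thesis .
qed

lemma cell_mean_diff_le:
  assumes u: "continuous_on K u" and w: "w \<in> words N n" and x: "x \<in> cell w"
    and osc: "\<And>y. y \<in> cell w \<Longrightarrow> \<bar>u y - u x\<bar> \<le> e"
  shows "\<bar>cell_mean u w - u x\<bar> \<le> e"
proof -
  note [measurable] = continuous_on_K_measurable[OF u] measurable_word_map[OF w]
  obtain B where B: "\<And>x. x \<in> K \<Longrightarrow> \<bar>u x\<bar> \<le> B"
    using bounded_on_K[OF u] by blast
  have one: "measure \<mu> K = 1"
    using emeasure_mu_K by (simp add: measure_def)
  have int: "integrable \<mu> (\<lambda>y. u (word_map F w y))"
    using B word_map_in_K[OF w] by (intro integrable_const_bound[of _ B]) (auto intro!: AE_I2)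
  have "cell_mean u w - u x = (\<integral>y. u (word_map F w y) - u x \<partial>\<mu>)"
    using int by (simp add: cell_mean_def one)
  also have "\<bar>\<dots>\<bar> \<le> (\<integral>y. \<bar>u (word_map F w y) - u x\<bar> \<partial>\<mu>)"
    by (rule integral_abs_bound)
  also have "\<dots> \<le> (\<integral>y. e \<partial>\<mu>)"
    using int osc by (intro integral_mono) auto
  finally show ?thesis by (simp add: one)
qed

lemma cell_mean_tendsto:
  assumes u: "continuous_on K u" and w: "w \<in> words N n" and \<omega>: "\<omega> \<in> infinite_words N"
  shows "(\<lambda>k. cell_mean u (w @ map \<omega> [0..<k])) \<longlonglongrightarrow> u (word_map F w (coding F K \<omega>))"
proof (rule LIMSEQ_I)
  fix e :: real assume "0 < e"
  let ?x = "word_map F w (coding F K \<omega>)"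
  have "uniformly_continuous_on K u"
    using u compact_K by (rule compact_uniformly_continuous)
  then obtain d where d: "d > 0" "\<And>x y. x \<in> K \<Longrightarrow> y \<in> K \<Longrightarrow> dist x y < d \<Longrightarrow> dist (u x) (u y) < e / 2"
    using \<open>0 < e\<close> unfolding uniformly_continuous_on_def by (metis half_gt_zero dist_commute)
  obtain n0 where n0: "\<And>n v x y. n \<ge> n0 \<Longrightarrow> v \<in> words N n \<Longrightarrow> x \<in> cell v \<Longrightarrow> y \<in> cell v \<Longrightarrow> dist x y < d"
    using cells_shrink[OF d(1)] by blast
  have "norm (cell_mean u (w @ map \<omega> [0..<k]) - u ?x) < e" if "k \<ge> n0" for k
  proof -
    let ?v = "w @ map \<omega> [0..<k]"
    have v: "?v \<in> words N (n + k)"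
      using words_append[OF w prefix_in_words[OF \<omega>]] .
    have sub: "cell ?v \<subseteq> K"
      using word_map_in_K[OF v] by blast
    have x: "?x \<in> cell ?v"
      using coding_in_cell[OF \<omega>, of k] by (auto simp: word_map_append)
    have "\<bar>cell_mean u ?v - u ?x\<bar> \<le> e / 2"
    proof (rule cell_mean_diff_le[OF u v x])
      fix y assume "y \<in> cell ?v"
      with x sub d(2)[of y ?x] n0[OF _ v] that show "\<bar>u y - u ?x\<bar> \<le> e / 2"
        by (auto simp: dist_real_def less_imp_le subset_iff)
    qed
    then show ?thesis using \<open>0 < e\<close> by simp
  qed
  then show "\<exists>n0. \<forall>k\<ge>n0. norm (cell_mean u (w @ map \<omega> [0..<k]) - u ?x) < e" by blast
qed

text \<open>
  A telescoping argument along the cells \<open>F\<^sub>w F\<^bsub>\<omega>|k\<^esub>(K)\<close> that shrink to the vertex, carried out for all words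
  \<open>w\<close> of level \<open>n\<close> at once. In the Euclidean norm over \<open>w\<close> the \<open>k\<close>-th difference of means is at most
  a constant times \<open>q\<^bsup>(n+k)/2\<^esup>\<close>, since the words \<open>w \<omega>|k\<close> are different words of level \<open>n + k\<close>. The series
  converges because \<open>q < 1\<close>.
\<close>

lemma vertex_minus_mean_bound:
  fixes C q :: real
  assumes u: "continuous_on K u" and \<omega>: "\<omega> \<in> infinite_words N"
    and q: "0 < q" "q < 1" and "0 \<le> C"
    and cells: "\<And>m. m \<ge> n \<Longrightarrow>
      (\<Sum>v\<in>words N m. \<integral>\<^sup>+x. \<integral>\<^sup>+y. ennreal (\<bar>u (word_map F v x) - u (word_map F v y)\<bar>\<^sup>2) \<partial>\<mu> \<partial>\<mu>)
        \<le> ennreal (C * q ^ m)"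
  shows "L2_set (\<lambda>w. u (word_map F w (coding F K \<omega>)) - cell_mean u w) (words N n)
    \<le> sqrt (real N * C * q ^ n) / (1 - sqrt q)"
proof -
  let ?p = "\<lambda>k. map \<omega> [0..<k]"
  let ?E = "\<lambda>v. \<integral>\<^sup>+x. \<integral>\<^sup>+y. ennreal (\<bar>u (word_map F v x) - u (word_map F v y)\<bar>\<^sup>2) \<partial>\<mu> \<partial>\<mu>"
  have \<omega>_letter: "\<omega> k \<in> {1..N}" for k
    using \<omega> unfolding infinite_words_def by blast
  have step: "L2_set (\<lambda>w. cell_mean u (w @ ?p (Suc k)) - cell_mean u (w @ ?p k)) (words N n)
      \<le> sqrt (real N * C * q ^ n) * sqrt q ^ k" for k
  proof -
    have "(\<Sum>w\<in>words N n. ?E (w @ ?p k)) = (\<Sum>v\<in>(\<lambda>w. w @ ?p k) ` words N n. ?E v)"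
      by (subst sum.reindex) (auto simp: inj_on_def)
    also have "\<dots> \<le> (\<Sum>v\<in>words N (n + k). ?E v)"
      using words_append[OF _ prefix_in_words[OF \<omega>]] by (intro sum_mono2) auto
    also have "\<dots> \<le> ennreal (C * q ^ (n + k))"
      by (rule cells) simp
    finally have cells_le: "(\<Sum>w\<in>words N n. ?E (w @ ?p k)) \<le> ennreal (C * q ^ (n + k))" .
    have "ennreal (\<Sum>w\<in>words N n. \<bar>cell_mean u (w @ ?p (Suc k)) - cell_mean u (w @ ?p k)\<bar>\<^sup>2)
        = (\<Sum>w\<in>words N n. ennreal (\<bar>cell_mean u ((w @ ?p k) @ [\<omega> k]) - cell_mean u (w @ ?p k)\<bar>\<^sup>2))"
      by (simp add: sum_ennreal)
    also have "\<dots> \<le> (\<Sum>w\<in>words N n. of_nat N * ?E (w @ ?p k))"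
      by (intro sum_mono cell_mean_child[OF u, where n = "n + k"] words_append prefix_in_words \<omega> \<omega>_letter)
    also have "\<dots> = of_nat N * (\<Sum>w\<in>words N n. ?E (w @ ?p k))"
      by (simp add: sum_distrib_left)
    also have "\<dots> \<le> of_nat N * ennreal (C * q ^ (n + k))"
      using cells_le by (rule mult_left_mono) simp
    also have "\<dots> = ennreal (real N * C * q ^ (n + k))"
      using \<open>0 \<le> C\<close> q by (simp add: ennreal_mult ennreal_of_nat_eq_real_of_nat mult.assoc)
    finally have "(\<Sum>w\<in>words N n. \<bar>cell_mean u (w @ ?p (Suc k)) - cell_mean u (w @ ?p k)\<bar>\<^sup>2)
        \<le> real N * C * q ^ (n + k)"
      using \<open>0 \<le> C\<close> q by (subst (asm) ennreal_le_iff) auto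
    then have "L2_set (\<lambda>w. cell_mean u (w @ ?p (Suc k)) - cell_mean u (w @ ?p k)) (words N n)
        \<le> sqrt (real N * C * q ^ (n + k))"
      unfolding L2_set_def by (intro real_sqrt_le_mono) simp
    also have "\<dots> = sqrt (real N * C * q ^ n) * sqrt q ^ k"
      by (simp add: power_add real_sqrt_mult real_sqrt_power)
    finally show ?thesis .
  qed
  have partial: "L2_set (\<lambda>w. cell_mean u (w @ ?p k) - cell_mean u w) (words N n)
      \<le> (\<Sum>j<k. sqrt (real N * C * q ^ n) * sqrt q ^ j)" for k
  proof (induction k)
    case (Suc k)
    have "L2_set (\<lambda>w. cell_mean u (w @ ?p (Suc k)) - cell_mean u w) (words N n)
        = L2_set (\<lambda>w. (cell_mean u (w @ ?p k) - cell_mean u w)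
            + (cell_mean u (w @ ?p (Suc k)) - cell_mean u (w @ ?p k))) (words N n)"
      by (simp add: algebra_simps)
    also have "\<dots> \<le> L2_set (\<lambda>w. cell_mean u (w @ ?p k) - cell_mean u w) (words N n)
        + L2_set (\<lambda>w. cell_mean u (w @ ?p (Suc k)) - cell_mean u (w @ ?p k)) (words N n)"
      by (rule L2_set_triangle_ineq)
    finally show ?case
      using Suc step[of k] by simp
  qed (simp add: L2_set_def)
  have s: "0 < sqrt q" "sqrt q < 1"
    using q by auto
  have bound: "L2_set (\<lambda>w. cell_mean u (w @ ?p k) - cell_mean u w) (words N n)
      \<le> sqrt (real N * C * q ^ n) / (1 - sqrt q)" for k
  proof -
    have "(\<Sum>j<k. sqrt q ^ j) \<le> 1 / (1 - sqrt q)"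
      using s by (simp add: sum_gp_strict divide_right_mono)
    then have "sqrt (real N * C * q ^ n) * (\<Sum>j<k. sqrt q ^ j) \<le> sqrt (real N * C * q ^ n) * (1 / (1 - sqrt q))"
      using \<open>0 \<le> C\<close> q by (intro mult_left_mono) auto
    with partial[of k] show ?thesis
      by (simp add: sum_distrib_left)
  qed
  have "(\<lambda>k. L2_set (\<lambda>w. cell_mean u (w @ ?p k) - cell_mean u w) (words N n))
      \<longlonglongrightarrow> L2_set (\<lambda>w. u (word_map F w (coding F K \<omega>)) - cell_mean u w) (words N n)"
    unfolding L2_set_def by (intro tendsto_intros cell_mean_tendsto[OF u _ \<omega>])
  then show ?thesis
    using bound by (intro LIMSEQ_le_const2) auto
qed

text \<open>
  The assumption \<open>\<alpha> < 2 \<sigma>\<close> makes the ratio \<open>q = \<rho>\<^bsup>2\<sigma>-\<alpha>\<^esup>\<close> less than \<open>1\<close>. The values at any two vertices of a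
  cell are compared through the mean over that cell.
\<close>

lemma primal_energy_le_besov:
  assumes u: "continuous_on K u" and fin: "besov_seminorm_sq \<mu> \<alpha> \<sigma> u < \<infinity>" and \<sigma>: "\<alpha> < 2 * \<sigma>"
  obtains C n0 where "0 \<le> C" "\<And>n. n \<ge> n0 \<Longrightarrow> primal_energy F N K n u \<le> C * (\<rho> powr (2 * \<sigma> - \<alpha>)) ^ n"
proof -
  define q where "q = \<rho> powr (2 * \<sigma> - \<alpha>)"
  have q: "0 < q" "q < 1"
    using rho \<sigma> powr_less_mono'[of \<rho> 0 "2 * \<sigma> - \<alpha>"] by (auto simp: q_def)
  obtain C n0 where C: "0 \<le> C" "\<And>m. m \<ge> n0 \<Longrightarrow>
    (\<Sum>v\<in>words N m. \<integral>\<^sup>+x. \<integral>\<^sup>+y. ennreal (\<bar>u (word_map F v x) - u (word_map F v y)\<bar>\<^sup>2) \<partial>\<mu> \<partial>\<mu>)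
      \<le> ennreal (C * q ^ m)"
    using sum_cells_le_besov[OF continuous_on_K_measurable[OF u] fin] unfolding q_def by blast
  define A where "A = 4 * (real N * C) / (1 - sqrt q)\<^sup>2"
  have A0: "0 \<le> A"
    using C(1) by (simp add: A_def)
  have edge: "(\<Sum>w\<in>words N n. \<bar>u (word_map F w p) - u (word_map F w p')\<bar>\<^sup>2) \<le> A * q ^ n"
    if "n \<ge> n0" "p \<in> V\<^sub>0" "p' \<in> V\<^sub>0" for n p p'
  proof -
    let ?b = "sqrt (real N * C * q ^ n) / (1 - sqrt q)"
    have vertex: "L2_set (\<lambda>w. u (word_map F w p) - cell_mean u w) (words N n) \<le> ?b" if "p \<in> V\<^sub>0" for p
    proof -
      obtain \<omega> where "\<omega> \<in> infinite_words N" "p = coding F K \<omega>"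
        using \<open>p \<in> V\<^sub>0\<close> post_critical_infinite_words unfolding boundary_def by blast
      then show ?thesis
        using vertex_minus_mean_bound[OF u _ q C(1), of \<omega> n] C(2) \<open>n \<ge> n0\<close> by simp
    qed
    have "L2_set (\<lambda>w. u (word_map F w p) - u (word_map F w p')) (words N n)
        = L2_set (\<lambda>w. (u (word_map F w p) - cell_mean u w) + (cell_mean u w - u (word_map F w p'))) (words N n)"
      by simp
    also have "\<dots> \<le> L2_set (\<lambda>w. u (word_map F w p) - cell_mean u w) (words N n)
        + L2_set (\<lambda>w. cell_mean u w - u (word_map F w p')) (words N n)"
      by (rule L2_set_triangle_ineq)
    also have "L2_set (\<lambda>w. cell_mean u w - u (word_map F w p')) (words N n)
        = L2_set (\<lambda>w. u (word_map F w p') - cell_mean u w) (words N n)"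
      by (simp add: L2_set_def power2_commute)
    finally have "L2_set (\<lambda>w. u (word_map F w p) - u (word_map F w p')) (words N n) \<le> 2 * ?b"
      using vertex[of p] vertex[of p'] that by simp
    then have "(L2_set (\<lambda>w. u (word_map F w p) - u (word_map F w p')) (words N n))\<^sup>2 \<le> (2 * ?b)\<^sup>2"
      by (intro power_mono L2_set_nonneg)
    also have "\<dots> = A * q ^ n"
      using C(1) q by (simp add: A_def power_divide power_mult_distrib)
    finally show ?thesis
      by (simp add: L2_set_def sum_nonneg)
  qed
  define B where "B = (1/2) * (\<Sum>p\<in>V\<^sub>0. \<Sum>p'\<in>V\<^sub>0 - {p}. A)"
  have "primal_energy F N K n u \<le> B * q ^ n" if "n \<ge> n0" for n
  proof -
    have "primal_energy F N K n u = (1/2) * (\<Sum>p\<in>V\<^sub>0. \<Sum>p'\<in>V\<^sub>0 - {p}.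
        \<Sum>w\<in>words N n. \<bar>u (word_map F w p) - u (word_map F w p')\<bar>\<^sup>2)"
      unfolding primal_energy_eq sum_distrib_left[symmetric]
      by (subst sum.swap, subst sum.swap) simp
    also have "\<dots> \<le> (1/2) * (\<Sum>p\<in>V\<^sub>0. \<Sum>p'\<in>V\<^sub>0 - {p}. A * q ^ n)"
      using edge[OF that] by (intro mult_left_mono sum_mono) auto
    finally show ?thesis
      by (simp add: B_def sum_distrib_right)
  qed
  then show thesis
    using A0 unfolding q_def by (intro that[of B n0]) (auto simp: B_def intro!: sum_nonneg)
qed

end

section \<open>Continuous functions of small energy\<close>

context homothetic_pcf
begin

text \<open>
  The range of the boundary data. Keeping extensions inside this interval substitutes for a maximum
  principle.
\<close>

abbreviation vmin :: "('a \<Rightarrow> real) \<Rightarrow> real" where "vmin g \<equiv> Min (g ` V\<^sub>0)"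
abbreviation vmax :: "('a \<Rightarrow> real) \<Rightarrow> real" where "vmax g \<equiv> Max (g ` V\<^sub>0)"

lemma vmin_vmax: "p \<in> V\<^sub>0 \<Longrightarrow> g p \<in> {vmin g..vmax g}"
  by simp

lemma vmin_le_vmax: "vmin g \<le> vmax g"
  using vmin_vmax boundary_nonempty by force

lemma vmin_ge: "(\<And>p. p \<in> V\<^sub>0 \<Longrightarrow> c \<le> g p) \<Longrightarrow> c \<le> vmin g"
  using boundary_nonempty by simp

lemma vmax_le: "(\<And>p. p \<in> V\<^sub>0 \<Longrightarrow> g p \<le> c) \<Longrightarrow> vmax g \<le> c"
  using boundary_nonempty by simp

text \<open>
  The extreme values are attained at vertices, and their difference is one term of the energy; the factor
  \<open>1/2\<close> is compensated by counting the pair in both orders.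
\<close>

lemma vrange_sq_le_energy: "(vmax g - vmin g)\<^sup>2 \<le> primal_energy F N K 0 g"
proof -
  have "vmax g \<in> g ` V\<^sub>0" "vmin g \<in> g ` V\<^sub>0"
    using boundary_nonempty by (auto intro!: Max_in Min_in)
  then obtain p q where p: "p \<in> V\<^sub>0" "vmax g = g p" and q: "q \<in> V\<^sub>0" "vmin g = g q" by blast
  show ?thesis
  proof (cases "p = q")
    case True
    then show ?thesis using p q primal_energy_nonneg by simp
  next
    case False
    let ?s = "\<lambda>x. \<Sum>y\<in>V\<^sub>0 - {x}. \<bar>g x - g y\<bar>\<^sup>2"
    have "\<bar>g p - g q\<bar>\<^sup>2 \<le> ?s p"
      using p q False by (intro member_le_sum[where f = "\<lambda>y. \<bar>g p - g y\<bar>\<^sup>2"]) auto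
    moreover have "\<bar>g q - g p\<bar>\<^sup>2 \<le> ?s q"
      using p q False by (intro member_le_sum[where f = "\<lambda>y. \<bar>g q - g y\<bar>\<^sup>2"]) auto
    moreover have "sum ?s {p, q} \<le> sum ?s V\<^sub>0"
      using p q by (intro sum_mono2) (auto intro!: sum_nonneg)
    ultimately have "2 * (g p - g q)\<^sup>2 \<le> sum ?s V\<^sub>0"
      using False by (simp add: power2_commute)
    then show ?thesis
      using p q by (simp add: primal_energy_eq)
  qed
qed

text \<open>
  The minimizer in the definition of the trace has energy \<open>\<Sum> |g(p) - g(q)|\<^sup>2 / r(p,q)\<close>, which is at most
  \<open>E\<^sub>0[g] / \<Lambda>\<close>. Clipping it to the range of \<open>g\<close> does not increase the energy. As the energy of level \<open>m\<close>
  only involves the finitely many vertices of that level, the extension from them to \<open>K\<close> is free, and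
  Tietze's theorem supplies a continuous one with the same range.
\<close>

lemma extension_of_small_energy:
  assumes tr: "is_trace F N K m r" and \<Lambda>: "0 < \<Lambda>"
    and le: "\<And>p q. p \<in> V\<^sub>0 \<Longrightarrow> q \<in> V\<^sub>0 \<Longrightarrow> p \<noteq> q \<Longrightarrow> \<Lambda> \<le> r p q"
  obtains h where "continuous_on K h" "\<And>p. p \<in> V\<^sub>0 \<Longrightarrow> h p = g p"
    "\<And>x. x \<in> K \<Longrightarrow> h x \<in> {vmin g..vmax g}"
    "\<Lambda> * primal_energy F N K m h \<le> primal_energy F N K 0 g"
proof -
  obtain v where v: "\<forall>x\<in>V\<^sub>0. v x = g x" "primal_energy F N K m v = pair_form V\<^sub>0 r g"
    using tr unfolding is_trace_def by blast
  define \<phi> where "\<phi> = (\<lambda>t. max (vmin g) (min (vmax g) t))"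
  have lip: "\<bar>\<phi> s - \<phi> t\<bar> \<le> \<bar>s - t\<bar>" for s t
    unfolding \<phi>_def by linarith
  have clip: "\<phi> t \<in> {vmin g..vmax g}" for t
    using vmin_le_vmax[of g] by (auto simp: \<phi>_def)
  have fix_bd: "\<phi> (v p) = g p" if "p \<in> V\<^sub>0" for p
    using v(1) that vmin_vmax[OF that, of g] by (simp add: \<phi>_def)
  define S where "S = V\<^sub>0 \<union> (\<Union>w\<in>words N m. word_map F w ` V\<^sub>0)"
  have S: "finite S" "S \<subseteq> K"
    using boundary_in_K word_map_in_K by (auto simp: S_def)
  have cl: "closedin (top_of_set K) S"
    using S by (intro closed_subset finite_imp_closed) auto
  have cont: "continuous_on S (\<phi> \<circ> v)"
    using S(1) by (rule continuous_on_finite)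
  obtain h where h: "continuous_on K h" "\<And>x. x \<in> S \<Longrightarrow> h x = (\<phi> \<circ> v) x"
    "\<And>x. x \<in> K \<Longrightarrow> h x \<in> cbox (vmin g) (vmax g)"
    using Tietze_closed_interval_1[OF cont cl vmin_le_vmax[of g]] clip
    unfolding cbox_interval o_def by blast
  show thesis
  proof (rule that)
    show "h p = g p" if "p \<in> V\<^sub>0" for p
      using h(2)[of p] fix_bd[OF that] that by (simp add: S_def)
    have "pair_form V\<^sub>0 r g \<le> (1/2) * (\<Sum>p\<in>V\<^sub>0. \<Sum>q\<in>V\<^sub>0 - {p}. (1 / \<Lambda>) * \<bar>g p - g q\<bar>\<^sup>2)"
      unfolding pair_form_def using le \<Lambda>
      by (intro mult_left_mono sum_mono mult_right_mono divide_left_mono) (auto intro!: mult_pos_pos less_le_trans[OF \<Lambda> le])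
    also have "\<dots> = primal_energy F N K 0 g / \<Lambda>"
      by (simp add: primal_energy_eq flip: sum_divide_distrib)
    finally have "primal_energy F N K m v \<le> primal_energy F N K 0 g / \<Lambda>"
      using v(2) by simp
    moreover have "primal_energy F N K m h = primal_energy F N K m (\<phi> \<circ> v)"
    proof (rule primal_energy_cong)
      fix w p assume "w \<in> words N m" "p \<in> V\<^sub>0"
      then have "word_map F w p \<in> S" unfolding S_def by blast
      then show "h (word_map F w p) = (\<phi> \<circ> v) (word_map F w p)" by (rule h(2))
    qed
    ultimately have "primal_energy F N K m h \<le> primal_energy F N K 0 g / \<Lambda>"
      using primal_energy_lipschitz[OF lip, of m v] by simp
    then show "\<Lambda> * primal_energy F N K m h \<le> primal_energy F N K 0 g"
      using \<Lambda> by (simp add: field_simps)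
  qed (use h in auto)
qed

text \<open>
  Functions prescribed on the cells agree on overlaps because cells overlap only in vertices, where the
  values are those of a common \<open>g\<close>.
\<close>

lemma glue_cells:
  fixes h :: "nat list \<Rightarrow> 'a \<Rightarrow> real"
  assumes cont: "\<And>w. w \<in> words N n \<Longrightarrow> continuous_on K (h w)"
    and bd: "\<And>w p. w \<in> words N n \<Longrightarrow> p \<in> V\<^sub>0 \<Longrightarrow> h w p = g (word_map F w p)"
  obtains G where "continuous_on K G"
    "\<And>w y. w \<in> words N n \<Longrightarrow> y \<in> K \<Longrightarrow> G (word_map F w y) = h w y"
proof -
  have consistent: "h w y = h v z"
    if "w \<in> words N n" "v \<in> words N n" "y \<in> K" "z \<in> K" "word_map F w y = word_map F v z" for w v y z
  proof (cases "w = v")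
    case True
    then show ?thesis using that by simp
  next
    case False
    have "y \<in> V\<^sub>0" "z \<in> V\<^sub>0"
      using that False cell_meets_in_boundary[of w n v y] cell_meets_in_boundary[of v n w z]
      by (metis imageI)+
    then show ?thesis using that bd by simp
  qed
  define G where "G = (\<lambda>x. SOME t. \<exists>w\<in>words N n. \<exists>y\<in>K. x = word_map F w y \<and> t = h w y)"
  have G: "G (word_map F w y) = h w y" if w: "w \<in> words N n" and y: "y \<in> K" for w y
    unfolding G_def
  proof (rule some_equality)
    show "\<exists>v\<in>words N n. \<exists>z\<in>K. word_map F w y = word_map F v z \<and> h w y = h v z"
      using w y by blast
    show "t = h w y" if t: "\<exists>v\<in>words N n. \<exists>z\<in>K. word_map F w y = word_map F v z \<and> t = h v z" for t
    proof -
      obtain v z where "v \<in> words N n" "z \<in> K" "word_map F w y = word_map F v z" "t = h v z"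
        using t by blast
      then show ?thesis using consistent[OF w _ y] by simp
    qed
  qed
  have "continuous_on (\<Union>w\<in>words N n. cell w) G"
  proof (rule continuous_on_closed_Union)
    fix w assume w: "w \<in> words N n"
    show "closed (cell w)"
      using compact_cell by (rule compact_imp_closed)
    \<comment> \<open>The inverse of \<open>F\<^sub>w\<close>.\<close>
    define J where "J = (\<lambda>x. (1 / \<rho> ^ n) *\<^sub>R (x - word_map F w 0))"
    have J: "J (word_map F w y) = y" for y
      using word_map_affine[of w y] rho length_words[OF w] by (simp add: J_def)
    have "continuous_on (cell w) (\<lambda>x. h w (J x))"
    proof (rule continuous_on_compose2[OF cont[OF w]])
      show "continuous_on (cell w) J"
        unfolding J_def by (intro continuous_intros)
    qed (use J in auto)
    then show "continuous_on (cell w) G"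
      by (rule continuous_on_eq) (use G[OF w] J in auto)
  qed simp
  then have "continuous_on K G"
    using K_eq_Union_cells[of n] by simp
  then show thesis using G by (rule that)
qed

text \<open>
  One step of the iteration: replace \<open>g\<close> inside each cell of level \<open>n\<close> by the extension of its vertex values.
  The energy \<open>m\<close> levels further down is smaller by the factor \<open>\<Lambda>\<close>, with no loss of constants.
\<close>

lemma refinement:
  assumes tr: "is_trace F N K m r" and \<Lambda>: "0 < \<Lambda>"
    and le: "\<And>p q. p \<in> V\<^sub>0 \<Longrightarrow> q \<in> V\<^sub>0 \<Longrightarrow> p \<noteq> q \<Longrightarrow> \<Lambda> \<le> r p q"
  shows "\<exists>G. continuous_on K G
    \<and> (\<forall>w\<in>words N n. \<forall>y\<in>K. G (word_map F w y) \<in> {vmin (g \<circ> word_map F w)..vmax (g \<circ> word_map F w)})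
    \<and> \<Lambda> * primal_energy F N K (n + m) G \<le> primal_energy F N K n g"
proof -
  have "\<exists>h. continuous_on K h \<and> (\<forall>p\<in>V\<^sub>0. h p = (g \<circ> word_map F w) p)
      \<and> (\<forall>x\<in>K. h x \<in> {vmin (g \<circ> word_map F w)..vmax (g \<circ> word_map F w)})
      \<and> \<Lambda> * primal_energy F N K m h \<le> primal_energy F N K 0 (g \<circ> word_map F w)" for w
  proof (rule extension_of_small_energy[OF tr \<Lambda>, where g = "g \<circ> word_map F w"])
    fix p q assume "p \<in> V\<^sub>0" "q \<in> V\<^sub>0" "p \<noteq> q"
    then show "\<Lambda> \<le> r p q" by (rule le)
  qed blast
  then obtain h where h: "\<And>w. continuous_on K (h w)"
    "\<And>w p. p \<in> V\<^sub>0 \<Longrightarrow> h w p = (g \<circ> word_map F w) p"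
    "\<And>w x. x \<in> K \<Longrightarrow> h w x \<in> {vmin (g \<circ> word_map F w)..vmax (g \<circ> word_map F w)}"
    "\<And>w. \<Lambda> * primal_energy F N K m (h w) \<le> primal_energy F N K 0 (g \<circ> word_map F w)"
    by metis
  obtain G where G: "continuous_on K G"
    "\<And>w y. w \<in> words N n \<Longrightarrow> y \<in> K \<Longrightarrow> G (word_map F w y) = h w y"
    using glue_cells[of n h g] h by (metis comp_apply)
  have "\<Lambda> * primal_energy F N K (n + m) G = (\<Sum>w\<in>words N n. \<Lambda> * primal_energy F N K m (G \<circ> word_map F w))"
    by (simp add: primal_energy_add sum_distrib_left)
  also have "\<dots> = (\<Sum>w\<in>words N n. \<Lambda> * primal_energy F N K m (h w))"
    by (intro sum.cong refl arg_cong2[of _ _ _ _ "(*)"] primal_energy_cong)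
      (simp add: G(2) word_map_in_K boundary_in_K)
  also have "\<dots> \<le> (\<Sum>w\<in>words N n. primal_energy F N K 0 (g \<circ> word_map F w))"
    by (intro sum_mono h)
  also have "\<dots> = primal_energy F N K n g"
    using primal_energy_add[of n 0 g] by simp
  finally show ?thesis
    using G h(3) by (intro exI[of _ G]) auto
qed

text \<open>
  The iteration starts from \<open>f\<close> itself at a level \<open>n0\<close> on whose cells \<open>f\<close> varies by less than \<open>e\<close>. From
  the step after \<open>k\<close> on, all iterates take values on a cell \<open>w\<close> of level \<open>n0 + m k\<close> between the extreme
  vertex values of the \<open>k\<close>-th iterate; \<open>d k w\<close> is the length of that interval. So the same
  quantity gives the uniform Cauchy property, the closeness to \<open>f\<close> (for \<open>k = 0\<close>) and the bound on the
  oscillation of the limit.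
\<close>

lemma approximation_of_small_energy:
  fixes f :: "'a \<Rightarrow> real"
  assumes tr: "is_trace F N K m r" and \<Lambda>: "1 < \<Lambda>"
    and le: "\<And>p q. p \<in> V\<^sub>0 \<Longrightarrow> q \<in> V\<^sub>0 \<Longrightarrow> p \<noteq> q \<Longrightarrow> \<Lambda> \<le> r p q"
    and f: "continuous_on K f" and e: "0 < e"
  obtains u n0 d C where "continuous_on K u" "\<And>x. x \<in> K \<Longrightarrow> \<bar>f x - u x\<bar> < e" "0 \<le> C"
    "\<And>k w x y. w \<in> words N (n0 + m * k) \<Longrightarrow> x \<in> cell w \<Longrightarrow> y \<in> cell w \<Longrightarrow> \<bar>u x - u y\<bar> \<le> d k w"
    "\<And>k. (\<Sum>w\<in>words N (n0 + m * k). (d k w)\<^sup>2) \<le> C / \<Lambda> ^ k"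
proof -
  have \<Lambda>0: "0 < \<Lambda>" using \<Lambda> by simp
  have "uniformly_continuous_on K f"
    using f compact_K by (rule compact_uniformly_continuous)
  then obtain \<delta> where \<delta>: "\<delta> > 0" "\<And>x y. x \<in> K \<Longrightarrow> y \<in> K \<Longrightarrow> dist x y < \<delta> \<Longrightarrow> dist (f x) (f y) < e"
    using e unfolding uniformly_continuous_on_def by (metis dist_commute)
  obtain n0 where "\<And>n w x y. n \<ge> n0 \<Longrightarrow> w \<in> words N n \<Longrightarrow> x \<in> cell w \<Longrightarrow> y \<in> cell w \<Longrightarrow> dist x y < \<delta>"
    using cells_shrink[OF \<delta>(1)] by blast
  then have n0: "\<And>w y z. w \<in> words N n0 \<Longrightarrow> y \<in> K \<Longrightarrow> z \<in> K \<Longrightarrow>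
      \<bar>f (word_map F w y) - f (word_map F w z)\<bar> < e"
    using \<delta>(2) word_map_in_K unfolding dist_real_def by (meson imageI order_refl)
  obtain T where T: "\<And>n g. continuous_on K (T n g)"
    "\<And>n g w y. w \<in> words N n \<Longrightarrow> y \<in> K \<Longrightarrow>
        T n g (word_map F w y) \<in> {vmin (g \<circ> word_map F w)..vmax (g \<circ> word_map F w)}"
    "\<And>n g. \<Lambda> * primal_energy F N K (n + m) (T n g) \<le> primal_energy F N K n g"
    using refinement[OF tr \<Lambda>0 le] by metis
  define L where "L = (\<lambda>k. n0 + m * k)"
  define G where "G = rec_nat f (\<lambda>k g. T (L k) g)"
  have G0: "G 0 = f" and GS: "G (Suc k) = T (L k) (G k)" for k
    by (auto simp: G_def)
  have LS: "L (Suc k) = L k + m" for k by (simp add: L_def)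
  have hull: "G (Suc k + j) (word_map F w y) \<in> {vmin (G k \<circ> word_map F w)..vmax (G k \<circ> word_map F w)}"
    if "w \<in> words N (L k)" "y \<in> K" for k j w y
    using that
  proof (induction j arbitrary: k w y)
    case 0
    then show ?case using T(2)[of w "L k" y "G k"] by (simp add: GS)
  next
    case (Suc j)
    obtain v z where v: "v \<in> words N m" and z: "z \<in> K" and y: "y = word_map F v z"
      using Suc.prems(2) by (rule point_in_cell)
    let ?g = "G (Suc k) \<circ> word_map F (w @ v)"
    have wv: "w @ v \<in> words N (L (Suc k))"
      using words_append[OF Suc.prems(1) v] by (simp add: LS)
    have vert: "?g p \<in> {vmin (G k \<circ> word_map F w)..vmax (G k \<circ> word_map F w)}" if "p \<in> V\<^sub>0" for p
      using T(2)[OF Suc.prems(1) word_map_in_K[OF v boundary_in_K[OF that]], of "G k"]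
      by (simp add: GS word_map_append)
    have "G (Suc (Suc k) + j) (word_map F (w @ v) z) \<in> {vmin ?g..vmax ?g}"
      by (rule Suc.IH[OF wv z])
    moreover have "vmin (G k \<circ> word_map F w) \<le> vmin ?g"
      using vert by (intro vmin_ge) simp
    moreover have "vmax ?g \<le> vmax (G k \<circ> word_map F w)"
      using vert by (intro vmax_le) simp
    ultimately show ?case
      by (simp add: y word_map_append)
  qed
  define C where "C = primal_energy F N K n0 f"
  have C0: "0 \<le> C"
    unfolding C_def by (rule primal_energy_nonneg)
  have energy: "primal_energy F N K (L k) (G k) \<le> C / \<Lambda> ^ k" for k
  proof (induction k)
    case 0
    then show ?case by (simp add: L_def G0 C_def)
  next
    case (Suc k)
    have "\<Lambda> * primal_energy F N K (L (Suc k)) (G (Suc k)) \<le> C / \<Lambda> ^ k"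
      using T(3)[of "L k" "G k"] Suc by (simp add: GS LS)
    then show ?case
      using \<Lambda>0 by (simp add: field_simps)
  qed
  define d where "d = (\<lambda>k w. vmax (G k \<circ> word_map F w) - vmin (G k \<circ> word_map F w))"
  have d_sum: "(\<Sum>w\<in>words N (L k). (d k w)\<^sup>2) \<le> C / \<Lambda> ^ k" for k
  proof -
    have "(\<Sum>w\<in>words N (L k). (d k w)\<^sup>2) \<le> (\<Sum>w\<in>words N (L k). primal_energy F N K 0 (G k \<circ> word_map F w))"
      unfolding d_def by (intro sum_mono vrange_sq_le_energy)
    also have "\<dots> = primal_energy F N K (L k) (G k)"
      using primal_energy_add[of "L k" 0 "G k"] by simp
    finally show ?thesis using energy[of k] by simp
  qed
  have d_le: "d k w \<le> sqrt (C / \<Lambda> ^ k)" if "w \<in> words N (L k)" for k w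
  proof -
    have "(d k w)\<^sup>2 \<le> (\<Sum>w\<in>words N (L k). (d k w)\<^sup>2)"
      using that by (intro member_le_sum[where f = "\<lambda>w. (d k w)\<^sup>2"]) auto
    then show ?thesis
      using d_sum[of k] by (intro real_le_rsqrt) simp
  qed
  have "uniformly_Cauchy_on K G"
  proof (rule uniformly_Cauchy_onI)
    fix \<epsilon> :: real assume \<epsilon>: "0 < \<epsilon>"
    have "(\<lambda>k. sqrt (C * (1 / \<Lambda>) ^ k)) \<longlonglongrightarrow> sqrt (C * 0)"
      using \<Lambda> by (intro tendsto_intros LIMSEQ_power_zero) auto
    then have "eventually (\<lambda>k. sqrt (C * (1 / \<Lambda>) ^ k) < \<epsilon>) sequentially"
      using \<epsilon> by (auto simp: order_tendsto_iff)
    then obtain k where k: "sqrt (C / \<Lambda> ^ k) < \<epsilon>"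
      by (auto simp: eventually_sequentially power_one_over)
    have "dist (G i x) (G j x) < \<epsilon>" if "x \<in> K" "i \<ge> Suc k" "j \<ge> Suc k" for x i j
    proof -
      obtain w y where w: "w \<in> words N (L k)" and y: "y \<in> K" "x = word_map F w y"
        using \<open>x \<in> K\<close> by (rule point_in_cell)
      have "\<bar>G i x - G j x\<bar> \<le> d k w"
        using hull[OF w y(1), of "i - Suc k"] hull[OF w y(1), of "j - Suc k"] that y(2)
        by (auto simp: d_def abs_le_iff)
      then show ?thesis
        using d_le[OF w] k by (simp add: dist_real_def)
    qed
    then show "\<exists>M. \<forall>x\<in>K. \<forall>i\<ge>M. \<forall>j\<ge>M. dist (G i x) (G j x) < \<epsilon>" by blast
  qed
  then obtain u where u: "uniform_limit K G u sequentially"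
    using Cauchy_uniformly_convergent unfolding uniformly_convergent_on_def by blast
  have contG: "continuous_on K (G k)" for k
    using f T(1) by (cases k) (simp_all add: G0 GS)
  have contu: "continuous_on K u"
    using u contG by (intro uniform_limit_theorem[of _ G sequentially]) auto
  have hull_u: "u (word_map F w y) \<in> {vmin (G k \<circ> word_map F w)..vmax (G k \<circ> word_map F w)}"
    if w: "w \<in> words N (L k)" and y: "y \<in> K" for k w y
  proof (rule Lim_in_closed_set)
    show "(\<lambda>i. G i (word_map F w y)) \<longlonglongrightarrow> u (word_map F w y)"
      using u word_map_in_K[OF w y] by (rule tendsto_uniform_limitI)
    show "eventually (\<lambda>i. G i (word_map F w y) \<in> {vmin (G k \<circ> word_map F w)..vmax (G k \<circ> word_map F w)}) sequentially"
      unfolding eventually_sequentially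
    proof (intro exI[of _ "Suc k"] allI impI)
      fix i assume "Suc k \<le> i"
      then show "G i (word_map F w y) \<in> {vmin (G k \<circ> word_map F w)..vmax (G k \<circ> word_map F w)}"
        using hull[OF w y, of "i - Suc k"] by simp
    qed
  qed auto
  show thesis
  proof (rule that[of u C n0 d])
    show "\<bar>f x - u x\<bar> < e" if x: "x \<in> K" for x
    proof -
      obtain w y where w: "w \<in> words N n0" and y: "y \<in> K" "x = word_map F w y"
        using x by (rule point_in_cell)
      have near: "f x - e < f (word_map F w p)" "f (word_map F w p) < f x + e" if "p \<in> V\<^sub>0" for p
        using n0[OF w y(1) boundary_in_K[OF that]] y(2) by (auto simp: abs_less_iff)
      have "vmin (f \<circ> word_map F w) > f x - e" "vmax (f \<circ> word_map F w) < f x + e"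
        using near boundary_nonempty by auto
      then show ?thesis
        using hull_u[of w 0 y] w y by (auto simp: L_def G0 abs_less_iff)
    qed
    show "\<bar>u x - u y\<bar> \<le> d k w"
      if wxy: "w \<in> words N (n0 + m * k)" "x \<in> cell w" "y \<in> cell w" for k w x y
    proof -
      obtain x' y' where xy: "x' \<in> K" "x = word_map F w x'" "y' \<in> K" "y = word_map F w y'"
        using wxy by blast
      have w: "w \<in> words N (L k)"
        using wxy by (simp add: L_def)
      show ?thesis
        using hull_u[OF w xy(1)] hull_u[OF w xy(3)] unfolding xy d_def by (auto simp: abs_le_iff)
    qed
  qed (use contu C0 d_sum in \<open>auto simp: L_def\<close>)
qed

end

context homothetic_pcf_measure
begin

lemma near_diagonal_energy_bounded:
  assumes "\<And>x. x \<in> K \<Longrightarrow> \<bar>u x\<bar> \<le> B"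
  shows "near_diagonal_energy u r \<le> ennreal (4 * B\<^sup>2)"
proof -
  have "near_diagonal_energy u r \<le> (\<integral>\<^sup>+x. \<integral>\<^sup>+y. ennreal (4 * B\<^sup>2) \<partial>\<mu> \<partial>\<mu>)"
    unfolding near_diagonal_energy_def
  proof (intro nn_integral_mono)
    fix x y assume "x \<in> space \<mu>" "y \<in> space \<mu>"
    then have "\<bar>u x - u y\<bar> \<le> 2 * B"
      using assms[of x] assms[of y] by simp
    then have "\<bar>u x - u y\<bar>\<^sup>2 \<le> (2 * B)\<^sup>2"
      by (intro power_mono) auto
    then show "ennreal (\<bar>u x - u y\<bar>\<^sup>2) * indicator (ball x r) y \<le> ennreal (4 * B\<^sup>2)"
      by (auto simp: indicator_def power_mult_distrib ennreal_leI)
  qed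
  also have "\<dots> = ennreal (4 * B\<^sup>2)"
    by (simp add: emeasure_mu_K)
  finally show ?thesis .
qed

lemma alpha_nonneg: "0 \<le> \<alpha>"
  using N_pos by (simp add: alpha)

text \<open>
  For small \<open>r\<close> choose the level \<open>n = n0 + m k\<close> with \<open>c \<rho>\<^bsup>n+m\<^esup> < r \<le> c \<rho>\<^sup>n\<close>, \<open>c\<close> being the separation constant
  of disjoint cells. Then \<open>r\<close>, up to constant factors, may be replaced by \<open>t = \<rho>\<^sup>n\<close>, the double integral
  is at most a constant times \<open>t\<^bsup>2\<alpha>\<^esup> / \<Lambda>\<^sup>k\<close>, and \<open>t\<^bsup>\<alpha>-2\<sigma>\<^esup> / \<Lambda>\<^sup>k\<close> is bounded by the assumption on \<open>\<Lambda>\<close>. For larger \<open>r\<close>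
  boundedness of \<open>u\<close> suffices. Levels in the arithmetic progression \<open>n0 + m k\<close> are enough since \<open>m\<close> is
  fixed.
\<close>

lemma besov_of_decaying_oscillation:
  assumes u: "continuous_on K u" and "0 < m" and \<sigma>: "0 < \<sigma>" and "0 \<le> C" and \<Lambda>: "0 < \<Lambda>"
    and osc: "\<And>k w x y. w \<in> words N (n0 + m * k) \<Longrightarrow> x \<in> cell w \<Longrightarrow> y \<in> cell w \<Longrightarrow> \<bar>u x - u y\<bar> \<le> d k w"
    and sum: "\<And>k. (\<Sum>w\<in>words N (n0 + m * k). (d k w)\<^sup>2) \<le> C / \<Lambda> ^ k"
    and decay: "1 \<le> (\<rho> powr (2 * \<sigma> - \<alpha>)) ^ m * \<Lambda>"
  shows "u \<in> besov \<mu> \<alpha> \<sigma>"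
proof -
  note um = continuous_on_K_measurable[OF u]
  obtain B where B: "\<And>x. x \<in> K \<Longrightarrow> \<bar>u x\<bar> \<le> B"
    using bounded_on_K[OF u] by blast
  obtain c where c: "0 < c" "\<And>n w v x y. w \<in> words N n \<Longrightarrow> v \<in> words N n \<Longrightarrow> cell w \<inter> cell v = {} \<Longrightarrow>
    x \<in> cell w \<Longrightarrow> y \<in> cell v \<Longrightarrow> c * \<rho> ^ n \<le> dist x y"
    using disjoint_cells_separated by blast
  define s where "s = \<alpha> + 2 * \<sigma>"
  have s: "0 < s" using alpha_nonneg \<sigma> by (simp add: s_def)
  define r0 where "r0 = c * \<rho> ^ n0"
  have r0: "0 < r0" using c rho by (simp add: r0_def)
  define A where "A = 4 * (real (card V\<^sub>0))\<^sup>2 * C"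
  have A: "0 \<le> A" using \<open>0 \<le> C\<close> by (simp add: A_def)
  define E where "E = (c * \<rho> ^ m) powr (- s) * (\<rho> ^ n0) powr (\<alpha> - 2 * \<sigma>) * A"
  have large: "ennreal (r powr (- s)) * near_diagonal_energy u r \<le> ennreal (r0 powr (- s) * (4 * B\<^sup>2))"
    if "r0 < r" for r
  proof -
    have "r powr (- s) \<le> r0 powr (- s)"
      using that r0 s by (intro powr_mono2') auto
    then have "ennreal (r powr (- s)) * near_diagonal_energy u r \<le> ennreal (r0 powr (- s)) * ennreal (4 * B\<^sup>2)"
      by (intro mult_mono near_diagonal_energy_bounded B ennreal_leI) auto
    then show ?thesis by (simp add: ennreal_mult)
  qed
  have small: "ennreal (r powr (- s)) * near_diagonal_energy u r \<le> ennreal E"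
    if r: "0 < r" "r \<le> r0" for r
  proof -
    \<comment> \<open>Choose the coarsest level whose successor in the progression is finer than \<open>r\<close>.\<close>
    have lim: "(\<lambda>k. r0 * (\<rho> ^ m) ^ Suc k) \<longlonglongrightarrow> 0"
    proof -
      have "\<rho> ^ m < 1"
        using rho \<open>0 < m\<close> by (simp add: power_less_one_iff)
      then have "(\<lambda>k. r0 * (\<rho> ^ m) ^ Suc k) \<longlonglongrightarrow> r0 * 0"
        using rho by (intro tendsto_intros LIMSEQ_Suc LIMSEQ_power_zero) auto
      then show ?thesis by simp
    qed
    then have "eventually (\<lambda>k. r0 * (\<rho> ^ m) ^ Suc k < r) sequentially"
      using r by (simp add: order_tendsto_iff del: power_Suc)
    then have ex: "\<exists>k. r0 * (\<rho> ^ m) ^ Suc k < r"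
      by (auto simp: eventually_sequentially simp del: power_Suc)
    define k where "k = (LEAST k. r0 * (\<rho> ^ m) ^ Suc k < r)"
    have k1: "r0 * (\<rho> ^ m) ^ Suc k < r"
      unfolding k_def using ex by (rule LeastI_ex)
    have k2: "r \<le> r0 * (\<rho> ^ m) ^ k"
    proof (cases k)
      case 0
      then show ?thesis using r by simp
    next
      case (Suc j)
      then have "\<not> r0 * (\<rho> ^ m) ^ Suc j < r"
        using not_less_Least[of j "\<lambda>k. r0 * (\<rho> ^ m) ^ Suc k < r"] by (simp add: k_def)
      then show ?thesis using Suc by (simp del: power_Suc)
    qed
    define n where "n = n0 + m * k"
    have rn: "r \<le> c * \<rho> ^ n"
      using k2 by (simp add: r0_def n_def power_add power_mult mult.assoc)
    have rn': "(c * \<rho> ^ m) * \<rho> ^ n \<le> r"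
    proof -
      have "(c * \<rho> ^ m) * \<rho> ^ n = r0 * (\<rho> ^ m) ^ Suc k"
        unfolding r0_def n_def power_add power_mult power_Suc by (simp only: mult_ac)
      then show ?thesis using k1 by (simp only: less_imp_le)
    qed
    have "of_nat N ^ (2 * n) * near_diagonal_energy u r
        \<le> ennreal (4 * (real (card V\<^sub>0))\<^sup>2 * (\<Sum>w\<in>words N n. (d k w)\<^sup>2))"
    proof (rule near_diagonal_energy_le_oscillations[OF um])
      show "r \<le> dist x y" if "w \<in> words N n" "v \<in> words N n" "cell w \<inter> cell v = {}"
        "x \<in> cell w" "y \<in> cell v" for w v x y
        using c(2)[OF that] rn by simp
    qed (use osc in \<open>auto simp: n_def\<close>)
    also have "\<dots> \<le> ennreal (A / \<Lambda> ^ k)"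
      using mult_left_mono[OF sum[of k], of "4 * (real (card V\<^sub>0))\<^sup>2"]
      by (intro ennreal_leI) (simp add: A_def n_def)
    finally have nd: "of_nat N ^ (2 * n) * near_diagonal_energy u r \<le> ennreal (A / \<Lambda> ^ k)" .
    define t where "t = \<rho> ^ n"
    have t: "0 < t" using rho by (simp add: t_def)
    have N2: "(of_nat N ^ (2 * n) :: ennreal) = ennreal (t powr (- 2 * \<alpha>))"
    proof -
      have "real N ^ (2 * n) = t powr (- 2 * \<alpha>)"
        unfolding mult_2 power_add N_power_eq by (simp add: t_def flip: powr_add)
      moreover have "(of_nat N ^ (2 * n) :: ennreal) = ennreal (real N ^ (2 * n))"
        by (simp add: ennreal_of_nat_eq_real_of_nat ennreal_power)
      ultimately show ?thesis by (simp only:)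
    qed
    have one: "ennreal (t powr (2 * \<alpha>)) * of_nat N ^ (2 * n) = 1"
      unfolding N2 using t by (simp flip: ennreal_mult powr_add)
    have "near_diagonal_energy u r = ennreal (t powr (2 * \<alpha>)) * (of_nat N ^ (2 * n) * near_diagonal_energy u r)"
      unfolding mult.assoc[symmetric] one by simp
    also have "\<dots> \<le> ennreal (t powr (2 * \<alpha>)) * ennreal (A / \<Lambda> ^ k)"
      using nd by (rule mult_left_mono) simp
    also have "\<dots> = ennreal (t powr (2 * \<alpha>) * (A / \<Lambda> ^ k))"
      using A \<Lambda> by (intro ennreal_mult[symmetric]) auto
    finally have nd': "near_diagonal_energy u r \<le> ennreal (t powr (2 * \<alpha>) * (A / \<Lambda> ^ k))" .
    have rs: "r powr (- s) \<le> (c * \<rho> ^ m) powr (- s) * t powr (- s)"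
    proof -
      have "r powr (- s) \<le> ((c * \<rho> ^ m) * t) powr (- s)"
        using rn' s c t rho by (intro powr_mono2') (auto simp: t_def)
      then show ?thesis
        using c t rho by (simp add: powr_mult)
    qed
    have tk: "t powr (\<alpha> - 2 * \<sigma>) / \<Lambda> ^ k \<le> (\<rho> ^ n0) powr (\<alpha> - 2 * \<sigma>)"
    proof -
      have "t powr (\<alpha> - 2 * \<sigma>) = (\<rho> ^ n0) powr (\<alpha> - 2 * \<sigma>) * ((\<rho> ^ m) powr (\<alpha> - 2 * \<sigma>)) ^ k"
        using rho by (simp add: t_def n_def power_add power_mult powr_mult powr_realpow[symmetric] powr_powr mult_ac)
      moreover have "((\<rho> ^ m) powr (\<alpha> - 2 * \<sigma>)) ^ k \<le> \<Lambda> ^ k"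
      proof (rule power_mono)
        have "(\<rho> ^ m) powr (\<alpha> - 2 * \<sigma>) * (\<rho> powr (2 * \<sigma> - \<alpha>)) ^ m = 1"
          using rho by (simp add: powr_realpow[symmetric] powr_powr algebra_simps flip: powr_add)
        then show "(\<rho> ^ m) powr (\<alpha> - 2 * \<sigma>) \<le> \<Lambda>"
          using mult_left_mono[OF decay, of "(\<rho> ^ m) powr (\<alpha> - 2 * \<sigma>)"] by (simp flip: mult.assoc)
      qed simp
      ultimately show ?thesis
        using \<Lambda> by (simp add: divide_le_eq mult_left_mono)
    qed
    have "ennreal (r powr (- s)) * near_diagonal_energy u r
        \<le> ennreal ((c * \<rho> ^ m) powr (- s) * t powr (- s)) * ennreal (t powr (2 * \<alpha>) * (A / \<Lambda> ^ k))"
      by (intro mult_mono ennreal_leI rs nd') auto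
    also have "\<dots> = ennreal ((c * \<rho> ^ m) powr (- s) * t powr (- s) * (t powr (2 * \<alpha>) * (A / \<Lambda> ^ k)))"
      using A \<Lambda> by (intro ennreal_mult[symmetric]) auto
    also have "(c * \<rho> ^ m) powr (- s) * t powr (- s) * (t powr (2 * \<alpha>) * (A / \<Lambda> ^ k))
        = (c * \<rho> ^ m) powr (- s) * (t powr (\<alpha> - 2 * \<sigma>) / \<Lambda> ^ k) * A"
    proof -
      have "t powr (\<alpha> - 2 * \<sigma>) = t powr (- s) * t powr (2 * \<alpha>)"
        by (simp add: s_def flip: powr_add)
      then show ?thesis by simp
    qed
    also have "\<dots> \<le> E"
      unfolding E_def using tk A by (intro mult_right_mono mult_left_mono) auto
    finally show ?thesis
      by (simp add: ennreal_leI)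
  qed
  have "besov_seminorm_sq \<mu> \<alpha> \<sigma> u \<le> max (ennreal (r0 powr (- s) * (4 * B\<^sup>2))) (ennreal E)"
    unfolding besov_seminorm_sq_def
  proof (rule SUP_least)
    fix r :: real assume "r \<in> {0<..<1}"
    then have "ennreal (r powr (- s)) * near_diagonal_energy u r \<le> max (ennreal (r0 powr (- s) * (4 * B\<^sup>2))) (ennreal E)"
      using large[of r] small[of r] by (cases "r \<le> r0") (auto simp: le_max_iff_disj)
    then show "ennreal (r powr (- \<alpha> - 2 * \<sigma>)) * (\<integral>\<^sup>+x. (\<integral>\<^sup>+y\<in>ball x r. ennreal (\<bar>u x - u y\<bar>\<^sup>2) \<partial>\<mu>) \<partial>\<mu>)
        \<le> max (ennreal (r0 powr (- s) * (4 * B\<^sup>2))) (ennreal E)"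
      unfolding near_diagonal_energy_def s_def by simp
  qed
  also have "\<dots> < \<infinity>"
    by (simp add: max_def)
  finally have fin: "besov_seminorm_sq \<mu> \<alpha> \<sigma> u < \<infinity>" .
  have "(\<integral>\<^sup>+x. ennreal (\<bar>u x\<bar>\<^sup>2) \<partial>\<mu>) \<le> (\<integral>\<^sup>+x. ennreal (B\<^sup>2) \<partial>\<mu>)"
    using B by (intro nn_integral_mono ennreal_leI power_mono) auto
  also have "\<dots> < \<infinity>"
    by (simp add: emeasure_mu_K)
  finally show ?thesis
    using fin um by (simp add: besov_def)
qed

end

section \<open>The critical exponent\<close>

lemma dense_in_CE:
  assumes "dense_in_C K S" "continuous_on K f" "0 < \<epsilon>"
  obtains u where "u \<in> S" "continuous_on K u" "\<And>x. x \<in> K \<Longrightarrow> \<bar>f x - u x\<bar> < \<epsilon>"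
  using assms unfolding dense_in_C_def by blast

context homothetic_pcf_measure
begin

text \<open>
  One level \<open>m\<close> with large traces is enough, because the refinement step can be iterated without any loss.
\<close>

lemma dense_if_trace_large:
  assumes tr: "is_trace F N K m r" and "0 < m" and \<sigma>: "0 < \<sigma>" and \<Lambda>: "1 < \<Lambda>"
    and le: "\<And>p q. p \<in> V\<^sub>0 \<Longrightarrow> q \<in> V\<^sub>0 \<Longrightarrow> p \<noteq> q \<Longrightarrow> \<Lambda> \<le> r p q"
    and decay: "1 \<le> (\<rho> powr (2 * \<sigma> - \<alpha>)) ^ m * \<Lambda>"
  shows "dense_in_C K (besov \<mu> \<alpha> \<sigma>)"
  unfolding dense_in_C_def
proof (intro allI impI)
  fix f :: "'a \<Rightarrow> real" and e :: real
  assume f: "continuous_on K f" and e: "0 < e"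
  show "\<exists>u\<in>besov \<mu> \<alpha> \<sigma>. continuous_on K u \<and> (\<forall>x\<in>K. \<bar>f x - u x\<bar> < e)"
  proof (rule approximation_of_small_energy[OF tr \<Lambda> _ f e])
    fix p q assume "p \<in> V\<^sub>0" "q \<in> V\<^sub>0" "p \<noteq> q"
    then show "\<Lambda> \<le> r p q" by (rule le)
  next
    fix u n0 d and C :: real
    assume u: "continuous_on K u" "\<And>x. x \<in> K \<Longrightarrow> \<bar>f x - u x\<bar> < e" "0 \<le> C"
      "\<And>k w x y. w \<in> words N (n0 + m * k) \<Longrightarrow> x \<in> cell w \<Longrightarrow> y \<in> cell w \<Longrightarrow> \<bar>u x - u y\<bar> \<le> d k w"
      "\<And>k. (\<Sum>w\<in>words N (n0 + m * k). (d k w)\<^sup>2) \<le> C / \<Lambda> ^ k"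
    have "u \<in> besov \<mu> \<alpha> \<sigma>"
      using besov_of_decaying_oscillation[OF u(1) \<open>0 < m\<close> \<sigma> u(3) _ u(4) u(5) decay] \<Lambda> by simp
    with u(1,2) show "\<exists>u\<in>besov \<mu> \<alpha> \<sigma>. continuous_on K u \<and> (\<forall>x\<in>K. \<bar>f x - u x\<bar> < e)" by blast
  qed
qed

text \<open>
  Density provides a continuous \<open>u\<close> in the Besov space with \<open>|u(p) - u(q)| \<ge> 1/2\<close>. By minimality of the trace,
  its energy is at least the single term \<open>|u(p) - u(q)|\<^sup>2 / R\<^sub>n(p,q)\<close> of the pair form.
\<close>

lemma trace_lower_bound_if_dense:
  assumes dense: "dense_in_C K (besov \<mu> \<alpha> \<sigma>)" and \<sigma>: "\<alpha> < 2 * \<sigma>"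
    and tr: "\<And>n. is_trace F N K n (Rn n)"
    and pq: "p \<in> V\<^sub>0" "q \<in> V\<^sub>0" "p \<noteq> q"
  obtains C n0 where "0 < C" "\<And>n. n \<ge> n0 \<Longrightarrow> (\<rho> powr (\<alpha> - 2 * \<sigma>)) ^ n / Rn n p q \<le> C"
proof -
  define f where "f = (\<lambda>x. dist x p / dist q p)"
  have "continuous_on K f"
    unfolding f_def using pq by (intro continuous_intros) auto
  then obtain u where u: "u \<in> besov \<mu> \<alpha> \<sigma>" "continuous_on K u" "\<And>x. x \<in> K \<Longrightarrow> \<bar>f x - u x\<bar> < 1 / 4"
    using dense_in_CE[OF dense, of f "1/4"] by auto
  have "f p = 0" "f q = 1"
    using pq by (auto simp: f_def)
  then have "1 / 2 \<le> \<bar>u p - u q\<bar>"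
    using u(3)[of p] u(3)[of q] boundary_in_K pq by (auto simp: abs_if split: if_splits)
  then have "(1 / 2)\<^sup>2 \<le> \<bar>u p - u q\<bar>\<^sup>2"
    by (intro power_mono) auto
  then have gap: "1 / 4 \<le> \<bar>u p - u q\<bar>\<^sup>2"
    by (simp add: power_divide)
  obtain C n0 where C: "0 \<le> C" "\<And>n. n \<ge> n0 \<Longrightarrow> primal_energy F N K n u \<le> C * (\<rho> powr (2 * \<sigma> - \<alpha>)) ^ n"
    using primal_energy_le_besov[OF u(2) _ \<sigma>] u(1) unfolding besov_def by blast
  have "(\<rho> powr (\<alpha> - 2 * \<sigma>)) ^ n / Rn n p q \<le> 8 * C + 1" if n: "n \<ge> n0" for n
  proof -
    have pos: "0 < Rn n x y" if "x \<in> V\<^sub>0" "y \<in> V\<^sub>0" "x \<noteq> y" for x y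
      using tr that unfolding is_trace_def by blast
    let ?t = "\<lambda>x y. (1 / Rn n x y) * \<bar>u x - u y\<bar>\<^sup>2"
    have nonneg: "0 \<le> ?t x y" if "x \<in> V\<^sub>0" "y \<in> V\<^sub>0 - {x}" for x y
      using pos[of x y] that by auto
    have "?t p q \<le> (\<Sum>y\<in>V\<^sub>0 - {p}. ?t p y)"
      using pq nonneg by (intro member_le_sum) auto
    also have "\<dots> \<le> (\<Sum>x\<in>V\<^sub>0. \<Sum>y\<in>V\<^sub>0 - {x}. ?t x y)"
      using pq nonneg by (intro member_le_sum[where f = "\<lambda>x. \<Sum>y\<in>V\<^sub>0 - {x}. ?t x y"] sum_nonneg) auto
    also have "\<dots> = 2 * pair_form V\<^sub>0 (Rn n) u"
      by (simp add: pair_form_def)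
    also have "pair_form V\<^sub>0 (Rn n) u \<le> primal_energy F N K n u"
      using tr unfolding is_trace_def by blast
    also have "\<dots> \<le> C * (\<rho> powr (2 * \<sigma> - \<alpha>)) ^ n"
      by (rule C(2)[OF n])
    finally have le: "?t p q \<le> 2 * (C * (\<rho> powr (2 * \<sigma> - \<alpha>)) ^ n)" by simp
    have "(1 / Rn n p q) * (1 / 4) \<le> ?t p q"
      using gap pos[OF pq] by (intro mult_left_mono) auto
    with le have "1 / Rn n p q \<le> 8 * C * (\<rho> powr (2 * \<sigma> - \<alpha>)) ^ n" by simp
    then have "(\<rho> powr (\<alpha> - 2 * \<sigma>)) ^ n * (1 / Rn n p q)
        \<le> (\<rho> powr (\<alpha> - 2 * \<sigma>)) ^ n * (8 * C * (\<rho> powr (2 * \<sigma> - \<alpha>)) ^ n)"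
      by (intro mult_left_mono) auto
    also have "\<dots> = 8 * C * (\<rho> powr (\<alpha> - 2 * \<sigma>) * \<rho> powr (2 * \<sigma> - \<alpha>)) ^ n"
      by (simp add: power_mult_distrib)
    also have "\<rho> powr (\<alpha> - 2 * \<sigma>) * \<rho> powr (2 * \<sigma> - \<alpha>) = 1"
      using rho by (simp flip: powr_add)
    finally show ?thesis by simp
  qed
  then show thesis
    using C(1) by (intro that[of "8 * C + 1" n0]) auto
qed

end

theorem theorem4p1:
  fixes \<rho> \<alpha> Rstar \<sigma>star :: real and N :: nat and b :: "nat \<Rightarrow> 'a::euclidean_space"
    and F :: "nat \<Rightarrow> 'a \<Rightarrow> 'a" and K V0 :: "'a set" and \<mu> :: "'a measure"
    and Rn :: "nat \<Rightarrow> 'a \<Rightarrow> 'a \<Rightarrow> real" and R :: "'a \<Rightarrow> 'a \<Rightarrow> real"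
  assumes rho: "0 < \<rho>" "\<rho> < 1"
    and F: "F = (\<lambda>i. homothety \<rho> (b i))"
    and K: "self_similar_set F N K" "connected K"
    and pcf: "pcf F N K"
    and V0: "V0 = boundary F N K" "2 \<le> card V0"
    and alpha: "\<alpha> = ln (real N) / \<bar>ln \<rho>\<bar>"
    and mu: "self_similar_measure F N K \<mu>"
    and trace: "\<And>n. is_trace F N K n (Rn n)"
    and rate: "\<And>p q. p \<in> V0 \<Longrightarrow> q \<in> V0 \<Longrightarrow> p \<noteq> q \<Longrightarrow> has_growth_rate (\<lambda>n. Rn n p q) (R p q)"
    and Rstar: "Rstar = Min {R p q |p q. p \<in> V0 \<and> q \<in> V0 \<and> p \<noteq> q}"
    and sigma_star: "\<sigma>star = (1/2) * (ln Rstar / (- ln \<rho>) + \<alpha>)"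
  shows "critical_exponent K \<mu> \<alpha> = ereal \<sigma>star \<and>
    ((\<forall>n. \<forall>p\<in>V0. \<forall>q\<in>V0. p \<noteq> q \<longrightarrow> Rstar ^ n \<le> Rn n p q) \<longrightarrow>
       dense_in_C K (besov \<mu> \<alpha> \<sigma>star)) \<and>
    ((\<exists>p\<in>V0. \<exists>q\<in>V0. p \<noteq> q \<and> filterlim (\<lambda>n. Rstar ^ n / Rn n p q) at_top sequentially) \<longrightarrow>
       \<not> dense_in_C K (besov \<mu> \<alpha> \<sigma>star))"
proof -
  interpret homothetic_pcf_measure \<rho> N b F K \<mu> \<alpha>
    using rho F K pcf V0 mu alpha by unfold_locales auto
  let ?S = "{R p q |p q. p \<in> V0 \<and> q \<in> V0 \<and> p \<noteq> q}"
  have finV: "finite V0" using V0 by simp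
  have finS: "finite ?S"
    by (rule finite_subset[of _ "(\<lambda>(p, q). R p q) ` (V0 \<times> V0)"]) (use finV in auto)
  have neS: "?S \<noteq> {}"
  proof -
    have "\<not> card V0 \<le> Suc 0" using V0 by simp
    then show ?thesis using finV by (auto simp: card_le_Suc0_iff_eq)
  qed
  have "Rstar \<in> ?S" unfolding Rstar using finS neS by (rule Min_in)
  then obtain p0 q0 where pq0: "p0 \<in> V0" "q0 \<in> V0" "p0 \<noteq> q0" "Rstar = R p0 q0" by blast
  have Rstar_gt: "1 < Rstar"
    using rate[OF pq0(1-3)] pq0(4) by (simp add: has_growth_rate_def)
  have Rstar_le: "Rstar \<le> R p q" if "p \<in> V0" "q \<in> V0" "p \<noteq> q" for p q
    unfolding Rstar using finS that by (intro Min_le) auto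
  have lnrho: "ln \<rho> < 0" using rho by simp
  have star: "\<rho> powr (\<alpha> - 2 * \<sigma>star) = Rstar"
  proof -
    have "(\<alpha> - 2 * \<sigma>star) * ln \<rho> = ln Rstar"
      using lnrho by (simp add: sigma_star field_simps)
    then show ?thesis using rho Rstar_gt by (simp add: powr_def)
  qed
  have star_inv: "\<rho> powr (2 * \<sigma>star - \<alpha>) * Rstar = 1"
    unfolding star[symmetric] using rho by (simp flip: powr_add)
  have \<sigma>_gap: "\<alpha> < 2 * \<sigma>star"
    using lnrho Rstar_gt by (simp add: sigma_star divide_pos_neg)
  then have \<sigma>_pos: "0 < \<sigma>star" using alpha_nonneg by simp

  have below: "dense_in_C K (besov \<mu> \<alpha> \<sigma>)" if \<sigma>: "0 < \<sigma>" "\<sigma> < \<sigma>star" for \<sigma>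
  proof -
    \<comment> \<open>The loss \<open>e\<close> in the growth rate is paid for by the gap \<open>\<sigma>star - \<sigma>\<close>: \<open>Rstar powr (1 - e)\<close> has to be at least
      \<open>\<rho> powr (\<alpha> - 2 * \<sigma>)\<close>. The minimum with \<open>1 / 2\<close> keeps the exponent \<open>1 - e\<close> positive.\<close>
    define e where "e = min (1 / 2) ((\<sigma>star - \<sigma>) / (2 * \<sigma>star - \<alpha>))"
    have e: "0 < e" "e < 1" "e * (2 * \<sigma>star - \<alpha>) \<le> \<sigma>star - \<sigma>"
      using \<sigma> \<sigma>_gap by (auto simp: e_def min_def field_simps split: if_splits)
    have "\<exists>M. \<forall>n\<ge>M. Rstar powr ((1 - e) * real n) \<le> Rn n p q"
      if pq: "p \<in> V0" "q \<in> V0" "p \<noteq> q" for p q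
    proof -
      obtain M where M: "\<And>n. n \<ge> M \<Longrightarrow> R p q powr ((1 - e) * real n) \<le> Rn n p q"
        using rate[OF pq] e(1) unfolding has_growth_rate_def by blast
      have "Rstar powr ((1 - e) * real n) \<le> R p q powr ((1 - e) * real n)" for n
        using Rstar_le[OF pq] Rstar_gt e by (intro powr_mono2) auto
      then show ?thesis using M by (meson order_trans)
    qed
    then obtain M where M: "\<And>p q n. p \<in> V0 \<Longrightarrow> q \<in> V0 \<Longrightarrow> p \<noteq> q \<Longrightarrow> n \<ge> M p q \<Longrightarrow>
        Rstar powr ((1 - e) * real n) \<le> Rn n p q"
      by metis
    define m where "m = Suc (Max ((\<lambda>(p, q). M p q) ` (V0 \<times> V0)))"
    have m: "M p q \<le> m" if "p \<in> V0" "q \<in> V0" for p q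
      unfolding m_def using finV that by (intro le_SucI Max_ge) auto
    define \<Lambda> where "\<Lambda> = Rstar powr ((1 - e) * real m)"
    have "1 < \<Lambda>"
      unfolding \<Lambda>_def using Rstar_gt e by (intro gr_one_powr) (auto simp: m_def)
    moreover have "1 \<le> (\<rho> powr (2 * \<sigma> - \<alpha>)) ^ m * \<Lambda>"
    proof -
      have "(2 * \<sigma> - \<alpha>) + (\<alpha> - 2 * \<sigma>star) * (1 - e) \<le> 0"
        using e(3) \<sigma> by (simp add: algebra_simps)
      then have "0 \<le> ((2 * \<sigma> - \<alpha>) + (\<alpha> - 2 * \<sigma>star) * (1 - e)) * real m * ln \<rho>"
        using lnrho by (intro mult_nonpos_nonpos mult_nonpos_nonneg) auto
      moreover have "(\<rho> powr (2 * \<sigma> - \<alpha>)) ^ m * \<Lambda>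
          = exp (((2 * \<sigma> - \<alpha>) + (\<alpha> - 2 * \<sigma>star) * (1 - e)) * real m * ln \<rho>)"
        unfolding \<Lambda>_def star[symmetric] using rho
        by (simp add: powr_powr powr_def exp_of_nat_mult[symmetric] exp_add[symmetric] algebra_simps)
      ultimately show ?thesis by simp
    qed
    moreover have "\<Lambda> \<le> Rn m p q" if "p \<in> V\<^sub>0" "q \<in> V\<^sub>0" "p \<noteq> q" for p q
      using M[of p q m] m[of p q] that V0(1) by (simp add: \<Lambda>_def)
    moreover have "0 < m" by (simp add: m_def)
    ultimately show ?thesis
      using dense_if_trace_large[OF trace[of m] _ \<sigma>(1)] by blast
  qed

  have above: "\<sigma> \<le> \<sigma>star" if \<sigma>: "dense_in_C K (besov \<mu> \<alpha> \<sigma>)" for \<sigma>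
  proof (rule ccontr)
    assume "\<not> \<sigma> \<le> \<sigma>star"
    then have gt: "\<sigma>star < \<sigma>" by simp
    with \<sigma>_gap have gap: "\<alpha> < 2 * \<sigma>" by simp
    \<comment> \<open>Half of the gap in \<open>2 * \<sigma>\<close> absorbs the error \<open>s\<close> in the growth rate; the other half leaves the
      diverging factor \<open>\<tau> ^ n\<close>.\<close>
    define s where "s = (\<sigma> - \<sigma>star) / (2 * \<sigma>star - \<alpha>)"
    have s: "0 < s" "s * (2 * \<sigma>star - \<alpha>) = \<sigma> - \<sigma>star"
      using gt \<sigma>_gap by (auto simp: s_def)
    obtain C n0 where C: "0 < C" "\<And>n. n \<ge> n0 \<Longrightarrow> (\<rho> powr (\<alpha> - 2 * \<sigma>)) ^ n / Rn n p0 q0 \<le> C"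
      using trace_lower_bound_if_dense[OF \<sigma> gap trace] pq0 V0(1) by metis
    obtain M where M: "\<And>n. n \<ge> M \<Longrightarrow> Rn n p0 q0 \<le> Rstar powr ((1 + s) * real n)"
      using rate[OF pq0(1-3)] s(1) pq0(4) unfolding has_growth_rate_def by blast
    have pos: "0 < Rn n p0 q0" for n
      using rate[OF pq0(1-3)] by (simp add: has_growth_rate_def)
    define \<tau> where "\<tau> = \<rho> powr (\<sigma>star - \<sigma>)"
    have "1 < \<tau>"
      using powr_less_mono'[of \<rho> "\<sigma>star - \<sigma>" 0] rho gt by (simp add: \<tau>_def)
    then obtain k where k: "C < \<tau> ^ k"
      using real_arch_pow by blast
    define n where "n = max k (max M n0)"
    have "\<tau> ^ k \<le> \<tau> ^ n"
      using \<open>1 < \<tau>\<close> by (intro power_increasing) (auto simp: n_def)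
    have "(\<rho> powr (\<alpha> - 2 * \<sigma>)) ^ n = \<tau> ^ n * Rstar powr ((1 + s) * real n)"
    proof -
      have "(\<alpha> - 2 * \<sigma>) = (\<sigma>star - \<sigma>) + (\<alpha> - 2 * \<sigma>star) * (1 + s)"
        using s(2) by (simp add: algebra_simps)
      then have "\<rho> powr (\<alpha> - 2 * \<sigma>) = \<tau> * Rstar powr (1 + s)"
        unfolding \<tau>_def star[symmetric] powr_powr powr_add[symmetric] by (rule arg_cong)
      then show ?thesis
        using Rstar_gt by (simp add: power_mult_distrib powr_powr flip: powr_realpow)
    qed
    also have "\<dots> \<ge> \<tau> ^ n * Rn n p0 q0"
      using M[of n] \<open>1 < \<tau>\<close> by (intro mult_left_mono) (auto simp: n_def)
    finally have "\<tau> ^ n \<le> (\<rho> powr (\<alpha> - 2 * \<sigma>)) ^ n / Rn n p0 q0"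
      using pos[of n] by (simp add: field_simps)
    also have "\<dots> \<le> C"
      using C(2)[of n] by (simp add: n_def)
    finally show False
      using k \<open>\<tau> ^ k \<le> \<tau> ^ n\<close> by simp
  qed

  have crit: "critical_exponent K \<mu> \<alpha> = ereal \<sigma>star"
    unfolding critical_exponent_def
  proof (rule antisym)
    show "(SUP \<sigma>\<in>{\<sigma>. 0 < \<sigma> \<and> dense_in_C K (besov \<mu> \<alpha> \<sigma>)}. ereal \<sigma>) \<le> ereal \<sigma>star"
      using above by (intro SUP_least) auto
    show "ereal \<sigma>star \<le> (SUP \<sigma>\<in>{\<sigma>. 0 < \<sigma> \<and> dense_in_C K (besov \<mu> \<alpha> \<sigma>)}. ereal \<sigma>)"
    proof (rule dense_le_bounded)
      show "ereal 0 < ereal \<sigma>star" using \<sigma>_pos by simp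
      fix w assume w: "ereal 0 < w" "w < ereal \<sigma>star"
      then obtain \<sigma> where "w = ereal \<sigma>" by (cases w) auto
      then show "w \<le> (SUP \<sigma>\<in>{\<sigma>. 0 < \<sigma> \<and> dense_in_C K (besov \<mu> \<alpha> \<sigma>)}. ereal \<sigma>)"
        using below w by (auto intro!: SUP_upper)
    qed
  qed

  have attained: "dense_in_C K (besov \<mu> \<alpha> \<sigma>star)"
    if large: "\<forall>n. \<forall>p\<in>V0. \<forall>q\<in>V0. p \<noteq> q \<longrightarrow> Rstar ^ n \<le> Rn n p q"
  proof (rule dense_if_trace_large[OF trace[of 1] _ \<sigma>_pos Rstar_gt])
    show "Rstar \<le> Rn 1 p q" if "p \<in> V\<^sub>0" "q \<in> V\<^sub>0" "p \<noteq> q" for p q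
      using large that V0(1) by (metis power_one_right)
  qed (use star_inv in auto)

  have not_attained: "\<not> dense_in_C K (besov \<mu> \<alpha> \<sigma>star)"
    if pq: "p \<in> V0" "q \<in> V0" "p \<noteq> q" and lim: "filterlim (\<lambda>n. Rstar ^ n / Rn n p q) at_top sequentially"
    for p q
  proof
    assume "dense_in_C K (besov \<mu> \<alpha> \<sigma>star)"
    then obtain C n0 where C: "\<And>n. n \<ge> n0 \<Longrightarrow> Rstar ^ n / Rn n p q \<le> C"
      using trace_lower_bound_if_dense[OF _ \<sigma>_gap trace, of p q] pq V0(1) star by metis
    have "eventually (\<lambda>n. C < Rstar ^ n / Rn n p q) sequentially"
      using lim by (simp add: filterlim_at_top_dense)
    moreover have "eventually (\<lambda>n. Rstar ^ n / Rn n p q \<le> C) sequentially"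
      using C by (auto simp: eventually_sequentially)
    ultimately have "eventually (\<lambda>n. False) sequentially"
      by eventually_elim simp
    then show False by simp
  qed

  show ?thesis
    using crit attained not_attained by blast
qed

end
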